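(* There exist absolute constants $C, c>0$ such that the following holds. Let $q$ be a prime power and let $E\subset \mathbb{F}_q^2$ with $|E|\ge C q^{8/7}$. Then \[|\Delta(E)\cdot \Delta(E)|\ge c\, q,\] where $\Delta(E)=\{\|x-y\|\colon x,y\in E\}$ and $\Delta(E)\cdot\Delta(E)=\{a b\colon a,b\in \Delta(E)\}$.
   Context: $\mathbb{F}_q$ is the finite field with $q$ elements. For $x=(x_1,x_2)\in\mathbb{F}_q^2$, $\|x\|=x_1^2+x_2^2\in\mathbb{F}_q$ (this is not a norm, just the quadratic form). The paper writes $X\gg Y$ to mean $X\ge CY$ for an absolute constant $C>0$; the statement "$|E|\gg q^{8/7}$ implies $|\Delta(E)\cdot\Delta(E)|\gg q$" is rendered above with explicit constants.
   Formalization: The prime power q is assumed odd: for even q, ‖x‖=(x₁+x₂)², so E={x : x₁+x₂∈S} with |S|≈Cq^{1/7} has |E|≥Cq^{8/7} but |Δ(E)·Δ(E)|≤|S|⁴=O(q^{4/7}), and the claim fails. The field F_q is taken, up to isomorphism, with natural numbers as elements. *)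

theory Defs
  imports Complex_Main "HOL-Algebra.Coset" "HOL-Algebra.Ring" "HOL-Number_Theory.Prime_Powers"
begin

definition qnorm :: "('a, 'b) ring_scheme \<Rightarrow> 'a \<times> 'a \<Rightarrow> 'a"
  where "qnorm F x = fst x [^]\<^bsub>F\<^esub> (2::nat) \<oplus>\<^bsub>F\<^esub> snd x [^]\<^bsub>F\<^esub> (2::nat)"

definition plane_diff :: "('a, 'b) ring_scheme \<Rightarrow> 'a \<times> 'a \<Rightarrow> 'a \<times> 'a \<Rightarrow> 'a \<times> 'a"
  where "plane_diff F x y = (fst x \<ominus>\<^bsub>F\<^esub> fst y, snd x \<ominus>\<^bsub>F\<^esub> snd y)"

definition distance_set :: "('a, 'b) ring_scheme \<Rightarrow> ('a \<times> 'a) set \<Rightarrow> 'a set"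
  where "distance_set F E = {qnorm F (plane_diff F x y) | x y. x \<in> E \<and> y \<in> E}"

text \<open>
  The constants in the theorem must be uniform over all finite fields, so the field is quantified
  inside the formula, as a ring record rather than as a type. Its carrier is a set of natural
  numbers; every finite field is isomorphic to such a field, and cardinalities of distance
  sets and of their product sets are invariant under field isomorphism.

  The product set \<open>\<Delta>(E) \<cdot> \<Delta>(E)\<close> is the library's \<open>set_mult\<close>, written \<open><#>\<close>.

  The field order is assumed odd, since the claim fails in characteristic two. There
  the quadratic form is \<open>(x1 + x2)^2\<close>. If \<open>q = r^2\<close> is even, \<open>K\<close> is the subfield of order \<open>r\<close> and
  \<open>E\<close> consists of the points with \<open>x1 + x2\<close> in \<open>K\<close>, then \<open>E\<close> has \<open>q powr (3/2)\<close> points, while both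
  its distance set and the product set are contained in \<open>K\<close>, which has only \<open>q powr (1/2)\<close> elements.
\<close>

end

theory Submission
  imports Defs "HOL-Analysis.Convex"
begin

text \<open>
  Identify the plane with \<open>A = F[i]\<close>, \<open>i^2 = -1\<close>, so that the quadratic form becomes the norm
  \<open>N z = z * cj z\<close>. Write \<open>n = |E|\<close>, let \<open>\<nu> r\<close> count the pairs of points of \<open>E\<close> at distance \<open>r\<close>, and let
  \<open>G\<close> be the group of nonzero elements of \<open>F\<close>.

  First, \<open>\<Sum>r\<in>G. (\<nu> r)^2\<close> is at most \<open>n\<close> times the number of isosceles triangles in \<open>E\<close>, that is, of
  incidences of points of \<open>E\<close> with perpendicular bisectors of pairs of points of \<open>E\<close>. The second
  moment of point-line incidences reduces this to counting pairs of pairs with the same bisector;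
  those correspond to congruent segments exchanged by a reflection, which are counted by a second
  moment again. The outcome is \<open>\<Sum>r\<in>G. (\<nu> r)^2 \<le> 4 n^4 / q + 8 q n^(5/2)\<close>.

  Second, multiplicative convolution with \<open>\<nu>\<close> has norm \<open>O(q n)\<close> on the functions of mean zero on \<open>G\<close>,
  because for \<open>y \<noteq> y'\<close> the number of \<open>x\<close> with \<open>N (x - y) = \<rho> * N (x - y') \<noteq> 0\<close> is the same for all
  \<open>\<rho> \<noteq> 1\<close> and at most one larger for \<open>\<rho> = 1\<close>. Applied to \<open>\<nu>\<close> minus its mean this bounds the
  multiplicative energy of \<open>\<nu>\<close> by \<open>O(n^8 / q + q n^6 + q^3 n^(9/2))\<close>, which is \<open>O(n^8 / q)\<close> as soon as
  \<open>n \<ge> q^(8/7)\<close>, and the Cauchy-Schwarz inequality gives the claim.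
\<close>

section \<open>Second moments\<close>

lemma card_filter_eq_sum:
  assumes "finite V"
  shows "real (card {v \<in> V. P v}) = (\<Sum>v\<in>V. of_bool (P v))"
  using assms by (simp add: Int_def sum_of_bool_eq)

lemma sum_card_relation:
  assumes "finite V" "finite W"
  shows "(\<Sum>w\<in>W. real (card {v \<in> V. P v w})) = (\<Sum>v\<in>V. real (card {w \<in> W. P v w}))"
  unfolding card_filter_eq_sum[OF assms(1)] card_filter_eq_sum[OF assms(2)] by (rule sum.swap)

text \<open>Expanding the square counts ordered pairs in \<open>V\<close> by their common partners
  in \<open>W\<close>. The variance bounds below thus reduce to bounds on common neighbours.\<close>

lemma sum_card_relation_square:
  assumes "finite V" "finite W"
  shows "(\<Sum>w\<in>W. (real (card {v \<in> V. P v w}))\<^sup>2)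
    = (\<Sum>v1\<in>V. \<Sum>v2\<in>V. real (card {w \<in> W. P v1 w \<and> P v2 w}))"
proof -
  have "(\<Sum>w\<in>W. (real (card {v \<in> V. P v w}))\<^sup>2)
    = (\<Sum>w\<in>W. \<Sum>v1\<in>V. \<Sum>v2\<in>V. of_bool (P v1 w \<and> P v2 w))"
    unfolding card_filter_eq_sum[OF assms(1)] power2_eq_square sum_product
    by (simp add: of_bool_conj)
  also have "\<dots> = (\<Sum>v1\<in>V. \<Sum>w\<in>W. \<Sum>v2\<in>V. of_bool (P v1 w \<and> P v2 w))"
    by (rule sum.swap)
  also have "\<dots> = (\<Sum>v1\<in>V. \<Sum>v2\<in>V. \<Sum>w\<in>W. of_bool (P v1 w \<and> P v2 w))"
    by (intro sum.cong refl sum.swap)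
  finally show ?thesis unfolding card_filter_eq_sum[OF assms(2)] .
qed

lemma sum_centered_square:
  fixes d :: "'a \<Rightarrow> real"
  shows "(\<Sum>w\<in>W. (d w - \<mu>)\<^sup>2) = (\<Sum>w\<in>W. (d w)\<^sup>2) - 2 * \<mu> * (\<Sum>w\<in>W. d w) + real (card W) * \<mu>\<^sup>2"
  by (simp add: power2_diff sum.distrib sum_subtractf flip: sum_distrib_left sum_distrib_right)

text \<open>Cauchy-Schwarz after subtracting \<open>\<mu>\<close> from \<open>d\<close>. With
  \<open>\<mu>\<close> the mean of \<open>d\<close>, the first term is the expected value and the
  second the error, as in an expander mixing bound.\<close>

lemma sum_mult_le_centered:
  fixes c d :: "'a \<Rightarrow> real"
  shows "(\<Sum>w\<in>W. c w * d w) \<le> \<mu> * (\<Sum>w\<in>W. c w) + sqrt ((\<Sum>w\<in>W. (c w)\<^sup>2) * (\<Sum>w\<in>W. (d w - \<mu>)\<^sup>2))"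
proof -
  have "(\<Sum>w\<in>W. c w * d w) = \<mu> * (\<Sum>w\<in>W. c w) + (\<Sum>w\<in>W. c w * (d w - \<mu>))"
    by (simp add: algebra_simps sum_subtractf sum_distrib_left)
  moreover have "(\<Sum>w\<in>W. c w * (d w - \<mu>)) \<le> sqrt ((\<Sum>w\<in>W. (c w)\<^sup>2) * (\<Sum>w\<in>W. (d w - \<mu>)\<^sup>2))"
    by (intro real_le_rsqrt Cauchy_Schwarz_ineq_sum)
  ultimately show ?thesis by simp
qed

lemma sum_square_le_card_sum_square:
  fixes f :: "'a \<Rightarrow> real"
  shows "(\<Sum>x\<in>X. f x)\<^sup>2 \<le> real (card X) * (\<Sum>x\<in>X. (f x)\<^sup>2)"
  using Cauchy_Schwarz_ineq_sum[of "\<lambda>_. 1" f X] by simp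

lemma card_Times_filter:
  assumes "finite B" "finite C"
  shows "card {w \<in> B \<times> C. P w} = (\<Sum>c\<in>C. card {b \<in> B. P (b, c)})"
proof -
  have "{w \<in> B \<times> C. P w} = prod.swap ` (SIGMA c:C. {b \<in> B. P (b, c)})" by force
  then have "card {w \<in> B \<times> C. P w} = card (SIGMA c:C. {b \<in> B. P (b, c)})"
    by (simp add: card_image)
  then show ?thesis using assms by simp
qed

lemma sum_swap_pairs:
  "(\<Sum>a\<in>A. \<Sum>b\<in>B. \<Sum>c\<in>C. \<Sum>d\<in>D. g a b c d) = (\<Sum>c\<in>C. \<Sum>d\<in>D. \<Sum>a\<in>A. \<Sum>b\<in>B. g a b c d)"
proof -
  have "(\<Sum>a\<in>A. \<Sum>b\<in>B. \<Sum>c\<in>C. \<Sum>d\<in>D. g a b c d) = (\<Sum>c\<in>C. \<Sum>a\<in>A. \<Sum>b\<in>B. \<Sum>d\<in>D. g a b c d)"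
    by (subst sum.swap[of _ C]) (intro sum.cong refl sum.swap)
  also have "\<dots> = (\<Sum>c\<in>C. \<Sum>a\<in>A. \<Sum>d\<in>D. \<Sum>b\<in>B. g a b c d)"
    by (intro sum.cong refl sum.swap)
  also have "\<dots> = (\<Sum>c\<in>C. \<Sum>d\<in>D. \<Sum>a\<in>A. \<Sum>b\<in>B. g a b c d)"
    by (intro sum.cong refl sum.swap)
  finally show ?thesis .
qed

section \<open>Planes with a conjugation\<close>

text \<open>An axiomatic form of \<open>F[i]\<close> over a field of odd order \<open>q\<close>,
  covering both the case where -1 is a square in the field (two isotropic lines, zero divisors) and
  the case where it is not. The unit is a parameter \<open>e\<close> because it need not be a unit
  of the ambient type. In characteristic two \<open>reduced\<close> would fail, since (1 + i)^2 = 0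
  there.\<close>

locale conj_plane =
  fixes A :: "'a::comm_ring set" and e :: 'a and cj :: "'a \<Rightarrow> 'a" and q :: nat
  assumes finite_A: "finite A" and q_ge: "q \<ge> 3"
    and zero_closed: "0 \<in> A" and unit_closed: "e \<in> A"
    and add_closed: "x \<in> A \<Longrightarrow> y \<in> A \<Longrightarrow> x + y \<in> A"
    and uminus_closed: "x \<in> A \<Longrightarrow> - x \<in> A"
    and mult_closed: "x \<in> A \<Longrightarrow> y \<in> A \<Longrightarrow> x * y \<in> A"
    and unit_mult: "x \<in> A \<Longrightarrow> e * x = x"
    and cj_closed: "x \<in> A \<Longrightarrow> cj x \<in> A"
    and cj_add: "x \<in> A \<Longrightarrow> y \<in> A \<Longrightarrow> cj (x + y) = cj x + cj y"
    and cj_mult: "x \<in> A \<Longrightarrow> y \<in> A \<Longrightarrow> cj (x * y) = cj x * cj y"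
    and cj_cj: "x \<in> A \<Longrightarrow> cj (cj x) = x"
    and reduced: "x \<in> A \<Longrightarrow> x * x = 0 \<Longrightarrow> x = 0"
    and real_unit: "x \<in> A \<Longrightarrow> cj x = x \<Longrightarrow> x \<noteq> 0 \<Longrightarrow> \<exists>y\<in>A. x * y = e"
    and two_nonzero: "e + e \<noteq> 0"
    and card_A: "card A = q\<^sup>2"
    and card_axis: "u \<in> A \<Longrightarrow> u * cj u = e \<Longrightarrow> card {t \<in> A. t + u * cj t = 0} = q"
    and norm_surj: "r \<in> A \<Longrightarrow> cj r = r \<Longrightarrow> r \<noteq> 0 \<Longrightarrow> \<exists>z\<in>A. z * cj z = r"
    and card_isotropic: "card {z \<in> A. z * cj z = 0} \<le> 2 * q - 1"
    and card_imaginary_units: "card {h \<in> A. cj h = - h \<and> h * h = e} \<le> 2"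
begin

definition N :: "'a \<Rightarrow> 'a" where "N z = z * cj z"
definition iv :: "'a \<Rightarrow> 'a" where "iv z = (SOME y. y \<in> A \<and> z * y = e)"
definition G :: "'a set" where "G = {r \<in> A. cj r = r \<and> r \<noteq> 0}"
definition S :: "'a \<Rightarrow> 'a set" where "S r = {s \<in> A. N s = r}"

section \<open>Norms, inverses and cancellation\<close>

lemma diff_closed: "x \<in> A \<Longrightarrow> y \<in> A \<Longrightarrow> x - y \<in> A"
  using add_closed[of x "- y"] uminus_closed by simp

lemmas closed = zero_closed unit_closed add_closed uminus_closed mult_closed cj_closed diff_closed

lemma mult_unit: "x \<in> A \<Longrightarrow> x * e = x"
  by (metis mult.commute unit_mult)

lemma cj_zero: "cj 0 = 0"
  using cj_add[of 0 0] zero_closed by simp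

lemma cj_uminus: "x \<in> A \<Longrightarrow> cj (- x) = - cj x"
  using cj_add[of x "- x"] by (simp add: closed cj_zero eq_neg_iff_add_eq_0 add.commute)

lemma cj_diff: "x \<in> A \<Longrightarrow> y \<in> A \<Longrightarrow> cj (x - y) = cj x - cj y"
  using cj_add[of x "- y"] by (simp add: closed cj_uminus)

lemma cj_unit: "cj e = e"
  using cj_mult[of e "cj e"] by (simp add: closed unit_mult cj_cj mult_unit)

lemmas cj_simps = cj_zero cj_unit cj_add cj_mult cj_cj cj_uminus cj_diff

lemma N_closed: "z \<in> A \<Longrightarrow> N z \<in> A"
  by (simp add: N_def closed)

lemma cj_N: "z \<in> A \<Longrightarrow> cj (N z) = N z"
  by (simp add: N_def closed cj_simps mult.commute)

lemma N_mult: "x \<in> A \<Longrightarrow> y \<in> A \<Longrightarrow> N (x * y) = N x * N y"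
  by (simp add: N_def cj_mult ac_simps)

lemma N_cj: "z \<in> A \<Longrightarrow> N (cj z) = N z"
  by (simp add: N_def cj_cj mult.commute)

lemma N_zero: "N 0 = 0"
  by (simp add: N_def)

lemma N_unit: "N e = e"
  by (simp add: N_def cj_unit unit_mult unit_closed)

lemma N_in_G: "z \<in> A \<Longrightarrow> N z \<noteq> 0 \<Longrightarrow> N z \<in> G"
  by (simp add: G_def N_closed cj_N)

lemma unit_nonzero: "e \<noteq> 0"
  using two_nonzero by auto

lemma unit_in_G: "e \<in> G"
  by (simp add: G_def unit_closed cj_unit unit_nonzero)

text \<open>The inverse is \<open>cj z\<close> divided by \<open>N z\<close>: a nonzero norm is
  fixed by conjugation, so \<open>real_unit\<close> inverts it.\<close>

lemma iv:
  assumes "z \<in> A" "N z \<noteq> 0"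
  shows iv_closed: "iv z \<in> A" and mult_iv: "z * iv z = e"
proof -
  obtain y where "y \<in> A" "N z * y = e"
    using real_unit[of "N z"] assms by (auto simp: N_closed cj_N)
  then have "\<exists>y. y \<in> A \<and> z * y = e"
    using assms by (intro exI[of _ "cj z * y"]) (simp add: closed N_def mult.assoc)
  then have "iv z \<in> A \<and> z * iv z = e"
    unfolding iv_def by (rule someI_ex)
  then show "iv z \<in> A" "z * iv z = e" by auto
qed

text \<open>There may be zero divisors, so cancellation is available for anisotropic factors
  only.\<close>

lemma cancel_zero:
  assumes "x \<in> A" "y \<in> A" "N x \<noteq> 0" "x * y = 0"
  shows "y = 0"
proof -
  have "y = iv x * (x * y)"
    using mult_iv[OF assms(1,3)] unit_mult[OF assms(2)] by (metis mult.assoc mult.commute)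
  then show ?thesis using assms(4) by simp
qed

lemma cancel:
  assumes "x \<in> A" "y \<in> A" "z \<in> A" "N x \<noteq> 0" "x * y = x * z"
  shows "y = z"
  using cancel_zero[of x "y - z"] assms by (simp add: closed right_diff_distrib)

lemma N_G: "r \<in> G \<Longrightarrow> N r \<noteq> 0"
  using reduced[of r] by (auto simp: G_def N_def)

lemma G_closed: "r \<in> G \<Longrightarrow> r \<in> A"
  by (simp add: G_def)

lemma mult_in_G: "r \<in> G \<Longrightarrow> s \<in> G \<Longrightarrow> r * s \<in> G"
  using cancel_zero[of r s] N_G by (auto simp: G_def closed cj_simps)

lemma iv_in_G:
  assumes "r \<in> G" shows "iv r \<in> G"
proof -
  have r: "r \<in> A" "N r \<noteq> 0" "cj r = r" using assms N_G by (auto simp: G_def)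
  have "r * cj (iv r) = cj (r * iv r)" using r iv_closed[OF r(1,2)] by (simp add: cj_mult)
  then have "r * cj (iv r) = r * iv r" using mult_iv[OF r(1,2)] by (simp add: cj_unit)
  then have "cj (iv r) = iv r" using cancel r iv_closed[OF r(1,2)] by (meson cj_closed)
  moreover have "iv r \<noteq> 0" using mult_iv[OF r(1,2)] unit_nonzero by auto
  ultimately show ?thesis using iv_closed[OF r(1,2)] by (simp add: G_def)
qed

lemma N_mult_nonzero: "x \<in> A \<Longrightarrow> y \<in> A \<Longrightarrow> N x \<noteq> 0 \<Longrightarrow> N y \<noteq> 0 \<Longrightarrow> N (x * y) \<noteq> 0"
  using mult_in_G[of "N x" "N y"] N_in_G by (auto simp: N_mult G_def)

lemma N_iv_nonzero:
  assumes "z \<in> A" "N z \<noteq> 0" shows "N (iv z) \<noteq> 0"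
proof
  assume "N (iv z) = 0"
  then have "N (z * iv z) = 0" using assms iv_closed by (simp add: N_mult)
  then show False using mult_iv[OF assms] by (simp add: N_unit unit_nonzero)
qed

text \<open>Equality of the norms says \<open>p * cj w + cj p * w = 0\<close>. Multiplying by
  \<open>w\<close> kills the first summand, so \<open>cj p * (w * w) = 0\<close>, and
  \<open>reduced\<close> applies. Hence distinct points of a circle of nonzero radius always differ
  by an anisotropic vector.\<close>

lemma isotropic_difference_eq_0:
  assumes p: "p \<in> A" "N p \<noteq> 0" and w: "w \<in> A" "N w = 0" and eq: "N (p + w) = N p"
  shows "w = 0"
proof -
  have 1: "w * cj w = 0" using w by (simp add: N_def)
  have "p * cj w + cj p * w = N (p + w) - N p - N w"
    using p w by (simp add: N_def cj_add algebra_simps)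
  then have "p * cj w + cj p * w = 0" using eq w by simp
  then have "(p * cj w + cj p * w) * w = 0" by simp
  then have "cj p * (w * w) + p * (w * cj w) = 0" by (simp add: algebra_simps)
  then have "cj p * (w * w) = 0" using 1 by simp
  then have "w * w = 0"
    using cancel_zero[of "cj p" "w * w"] p w by (simp add: closed N_cj)
  then show "w = 0" using reduced w by blast
qed

section \<open>Cardinalities of circles\<close>

lemma finite_G: "finite G" and finite_S: "finite (S r)"
  using finite_A by (auto simp: G_def S_def)

text \<open>The fixed points of conjugation are the case \<open>u = - e\<close> of
  \<open>card_axis\<close>.\<close>

lemma card_reals: "card {t \<in> A. cj t = t} = q"
proof -
  have "{t \<in> A. t + (- e) * cj t = 0} = {t \<in> A. cj t = t}"
    by (auto simp: closed unit_mult)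
  moreover have "(- e) * cj (- e) = e"
    using unit_closed by (simp add: cj_simps unit_mult)
  ultimately show ?thesis using card_axis[of "- e"] by (simp add: closed)
qed

lemma card_G: "card G = q - 1"
proof -
  have "G = {t \<in> A. cj t = t} - {0}" by (auto simp: G_def)
  then show ?thesis using card_reals zero_closed by (simp add: cj_zero)
qed

definition \<kappa> :: nat where "\<kappa> = card (S e)"

text \<open>Multiplication by an element of norm \<open>r\<close>, which exists by
  \<open>norm_surj\<close>, carries the unit circle onto \<open>S r\<close>.\<close>

lemma card_S:
  assumes "r \<in> G" shows "card (S r) = \<kappa>"
proof -
  obtain z where z: "z \<in> A" "N z = r" using norm_surj assms by (auto simp: G_def N_def)
  then have nz: "N z \<noteq> 0" using assms by (auto simp: G_def)
  have i: "iv z \<in> A" "z * iv z = e" using iv[OF z(1) nz] by auto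
  have "bij_betw (\<lambda>s. z * s) (S e) (S r)"
  proof (rule bij_betwI[where g = "\<lambda>s. iv z * s"])
    show "(\<lambda>s. z * s) \<in> S e \<rightarrow> S r"
      using z by (auto simp: S_def closed N_mult) (metis N_closed mult_unit)
    have "iv z * z = e" using i by (simp add: mult.commute)
    then have "N (iv z) * r = e" using N_mult[of "iv z" z] z i by (simp add: N_unit)
    then show "(\<lambda>s. iv z * s) \<in> S r \<rightarrow> S e"
      using i by (auto simp: S_def closed N_mult)
    show "iv z * (z * x) = x" if "x \<in> S e" for x
      using that i unit_mult[of x] by (simp add: S_def mult.assoc[symmetric] mult.commute[of "iv z"])
    show "z * (iv z * x) = x" if "x \<in> S r" for x
      using that i unit_mult[of x] by (simp add: S_def mult.assoc[symmetric])
  qed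
  then show ?thesis by (simp add: \<kappa>_def bij_betw_same_card)
qed

text \<open>The anisotropic elements split into \<open>q - 1\<close> circles of size
  \<open>\<kappa>\<close>, and between 1 and \<open>2 * q - 1\<close> elements are isotropic. So
  \<open>(q - 1) * \<kappa>\<close> lies between (q - 1)^2 and q^2 - 1.\<close>

lemma circle_bounds: shows kappa_ge: "q - 1 \<le> \<kappa>" and kappa_le: "\<kappa> \<le> q + 1"
proof -
  let ?Z = "{z \<in> A. N z = 0}"
  have "A - ?Z = (\<Union>r\<in>G. S r)" by (auto simp: S_def G_def N_closed cj_N)
  moreover have "card (\<Union>r\<in>G. S r) = (\<Sum>r\<in>G. card (S r))"
    by (intro card_UN_disjoint finite_G ballI finite_S) (auto simp: S_def)
  ultimately have 1: "card (A - ?Z) = (q - 1) * \<kappa>" by (simp add: card_S card_G)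
  have 2: "card (A - ?Z) = q\<^sup>2 - card ?Z"
    using finite_A by (subst card_Diff_subset) (auto simp: card_A)
  have Z: "card ?Z \<le> 2 * q - 1" using card_isotropic by (simp add: N_def)
  have "card {0 :: 'a} \<le> card ?Z"
    using finite_A zero_closed by (intro card_mono) (auto simp: N_zero)
  then have Z1: "1 \<le> card ?Z" by simp
  obtain m where m: "q = Suc m" "m > 0" using q_ge by (cases q) auto
  have "m * \<kappa> \<le> m * (m + 2)" using 1 2 Z1 m by (auto simp: power2_eq_square)
  then have "\<kappa> \<le> m + 2" using m by (simp only: mult_le_cancel1)
  then show "\<kappa> \<le> q + 1" using m by simp
  have "m * \<kappa> = (m * m + 2 * m + 1) - card ?Z" using 1 2 m by (simp add: power2_eq_square)
  then have "m * m \<le> m * \<kappa>" using Z m by linarith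
  then have "m \<le> \<kappa>" using m by (simp only: mult_le_cancel1)
  then show "q - 1 \<le> \<kappa>" using m by simp
qed
end

section \<open>Reflections and isosceles triangles\<close>

locale plane_set = conj_plane +
  fixes E :: "'a set"
  assumes E_subset: "E \<subseteq> A"
begin

lemma E_in_A: "x \<in> E \<Longrightarrow> x \<in> A"
  using E_subset by blast

lemma finite_E: "finite E"
  using E_subset finite_A finite_subset by blast

lemma card_E_le: "real (card E) \<le> (real q)\<^sup>2"
  using card_mono[OF finite_A E_subset] by (simp add: card_A flip: of_nat_power)

definition \<nu> :: "'a \<Rightarrow> nat" where "\<nu> r = card {(x, y). x \<in> E \<and> y \<in> E \<and> N (x - y) = r}"

text \<open>A pair \<open>(u, t)\<close> in \<open>L\<close> encodes the reflection \<open>z \<mapsto> u * cj z + t\<close>, hence its axis, a line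
  with anisotropic direction.\<close>

definition L :: "('a \<times> 'a) set"
  where "L = {(u, t). u \<in> A \<and> t \<in> A \<and> N u = e \<and> t + u * cj t = 0}"
definition reflect :: "'a \<times> 'a \<Rightarrow> 'a \<Rightarrow> 'a" where "reflect l z = fst l * cj z + snd l"
definition axis :: "'a \<times> 'a \<Rightarrow> 'a set" where "axis l = {x \<in> E. reflect l x = x}"
text \<open>Isotropic pairs, among them those with equal entries, are left out so that a pair
  determines its reflection.\<close>

definition mirrored :: "'a \<times> 'a \<Rightarrow> ('a \<times> 'a) set"
  where "mirrored l = {(y, z). y \<in> E \<and> z \<in> E \<and> N (y - z) \<noteq> 0 \<and> reflect l y = z}"

lemma finite_L: "finite L"
  by (rule finite_subset[of _ "A \<times> A"]) (auto simp: L_def finite_A)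

lemma finite_axis: "finite (axis l)"
  by (simp add: axis_def finite_E)

lemma finite_mirrored: "finite (mirrored l)"
  by (rule finite_subset[of _ "E \<times> E"]) (auto simp: mirrored_def finite_E)

lemma card_L: "card L = \<kappa> * q"
proof -
  have "L = (SIGMA u:S e. {t \<in> A. t + u * cj t = 0})" by (auto simp: L_def S_def)
  moreover have "card {t \<in> A. t + u * cj t = 0} = q" if "u \<in> S e" for u
    using that card_axis by (simp add: S_def N_def)
  ultimately show ?thesis using finite_A by (simp add: finite_S \<kappa>_def)
qed

section \<open>Reflections and perpendicular bisectors\<close>

lemma reflect_reflect:
  assumes "l \<in> L" "z \<in> A" shows "reflect l (reflect l z) = z"
proof -
  obtain u t where l: "l = (u, t)" "u \<in> A" "t \<in> A" "u * cj u = e" "t + u * cj t = 0"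
    using assms by (auto simp: L_def N_def)
  have "reflect l (reflect l z) = (u * cj u) * z + (t + u * cj t)"
    unfolding l(1) using l(2,3) assms(2) by (simp add: reflect_def closed cj_simps algebra_simps)
  then show ?thesis using l assms by (simp add: unit_mult)
qed

lemma reflect_diff:
  assumes "l \<in> L" "z \<in> A" "w \<in> A" shows "reflect l z - reflect l w = fst l * cj (z - w)"
  using assms by (simp add: reflect_def cj_diff algebra_simps)

text \<open>A reflection is an involution, so it also maps \<open>z\<close> to \<open>y\<close>.
  Subtracting the two equations determines the product of its first component with the anisotropic
  \<open>cj (y - z)\<close>, hence that component, and then the translation part.\<close>

lemma reflection_unique:
  assumes l: "l \<in> L" "l' \<in> L" and yz: "y \<in> A" "z \<in> A" "N (y - z) \<noteq> 0"
    and m: "reflect l y = z" "reflect l' y = z"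
  shows "l = l'"
proof -
  have a: "fst l \<in> A" "fst l' \<in> A" using l by (auto simp: L_def)
  have "reflect l z = y" "reflect l' z = y" using m l yz by (metis reflect_reflect)+
  then have "cj (y - z) * fst l = cj (y - z) * fst l'"
    using m reflect_diff[OF l(1) yz(1,2)] reflect_diff[OF l(2) yz(1,2)] by (simp add: mult.commute)
  then have "fst l = fst l'"
    using a yz cancel[of "cj (y - z)" "fst l" "fst l'"] by (simp add: closed N_cj)
  moreover from this have "snd l = snd l'" using m unfolding reflect_def by (metis add_left_cancel)
  ultimately show ?thesis by (simp add: prod_eq_iff)
qed

text \<open>With \<open>w = y - z\<close>, the linear part has to send \<open>cj w\<close> to
  \<open>- w\<close>, so it is \<open>- w\<close> divided by \<open>cj w\<close>, and the
  translation part is then forced by \<open>y \<mapsto> z\<close>. An equidistant \<open>x\<close>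
  is fixed because the difference of the two norms equals
  \<open>cj w * (x - z) + w * cj (x - y)\<close>.\<close>

lemma bisector_exists:
  assumes yz: "y \<in> A" "z \<in> A" "N (y - z) \<noteq> 0"
  shows "\<exists>l\<in>L. reflect l y = z \<and> (\<forall>x\<in>A. N (x - y) = N (x - z) \<longrightarrow> reflect l x = x)"
proof -
  define w where "w = y - z"
  have w: "w \<in> A" "N w \<noteq> 0" "cj w \<in> A" "N (cj w) \<noteq> 0" using yz by (auto simp: w_def closed N_cj)
  define i where "i = iv (cj w)"
  have i: "i \<in> A" "cj w * i = e" using iv[OF w(3,4)] by (auto simp: i_def)
  define u where "u = - w * i"
  have u: "u \<in> A" using w i by (simp add: u_def closed)
  have uw: "u * cj w = - w" using i w by (simp add: u_def mult.assoc mult.commute[of i] mult_unit)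
  have "cj u * w = - cj w" using arg_cong[OF uw, of cj] u w by (simp add: cj_simps)
  then have "(w * cj w) * (u * cj u) = (w * cj w) * e"
    using uw w by (simp add: mult_unit closed) (metis (no_types, lifting) minus_mult_minus mult.commute mult.left_commute)
  then have Nu: "N u = e"
    using cancel[of "w * cj w" "u * cj u" e] N_mult_nonzero[OF w(1,3,2,4)] w u
    by (simp add: closed N_def[of u])
  define t where "t = z - u * cj y"
  have t: "t \<in> A" using u yz by (simp add: t_def closed)
  have "t + u * cj t = z - u * cj w - (u * cj u) * y"
    using u yz by (simp add: t_def w_def cj_simps closed algebra_simps)
  also have "\<dots> = 0" using uw Nu yz by (simp add: N_def unit_mult w_def)
  finally have l: "(u, t) \<in> L" using u t Nu by (simp add: L_def)
  have "reflect (u, t) x = x" if x: "x \<in> A" "N (x - y) = N (x - z)" for x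
  proof -
    have "cj w * (x - z) + w * cj (x - y) = N (x - z) - N (x - y)"
      using x yz by (simp add: w_def N_def cj_simps algebra_simps)
    then have "cj w * (x - z) = - w * cj (x - y)" using x by (simp add: eq_neg_iff_add_eq_0)
    also have "\<dots> = cj w * (u * cj (x - y))" using uw by (simp flip: mult.assoc add: mult.commute)
    finally have "x - z = u * cj (x - y)"
      using cancel[of "cj w" "x - z" "u * cj (x - y)"] w u x yz by (simp add: closed)
    then show ?thesis using x yz by (simp add: reflect_def t_def cj_diff algebra_simps)
  qed
  then show ?thesis using l by (intro bexI[of _ "(u, t)"]) (auto simp: reflect_def t_def)
qed

lemma card_lines_through:
  assumes "x \<in> A" shows "card {l \<in> L. reflect l x = x} = \<kappa>"
proof -
  have "bij_betw (\<lambda>u. (u, x - u * cj x)) (S e) {l \<in> L. reflect l x = x}"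
  proof (rule bij_betwI[where g = fst])
    show "(\<lambda>u. (u, x - u * cj x)) \<in> S e \<rightarrow> {l \<in> L. reflect l x = x}"
    proof
      fix u assume u: "u \<in> S e"
      have "(x - u * cj x) + u * cj (x - u * cj x) = x - (u * cj u) * x"
        using u assms by (simp add: S_def cj_simps closed algebra_simps)
      also have "\<dots> = 0" using u assms by (simp add: S_def N_def unit_mult)
      finally show "(u, x - u * cj x) \<in> {l \<in> L. reflect l x = x}"
        using u assms by (simp add: S_def L_def reflect_def closed)
    qed
  qed (auto simp: L_def S_def reflect_def algebra_simps)
  then show ?thesis by (simp add: \<kappa>_def bij_betw_same_card)
qed

text \<open>If \<open>x - y\<close> is anisotropic, it determines the linear part. If it is
  isotropic, then \<open>x - y = u * cj (x - y)\<close> gives (x - y)^2 = u * N (x - y) = 0, so no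
  axis from \<open>L\<close> passes through both points.\<close>

lemma card_lines_through_two:
  assumes "x \<in> A" "y \<in> A" "x \<noteq> y" shows "card {l \<in> L. reflect l x = x \<and> reflect l y = y} \<le> 1"
proof -
  have "l = l'"
    if l: "l \<in> L" "reflect l x = x" "reflect l y = y" and l': "l' \<in> L" "reflect l' x = x" "reflect l' y = y" for l l'
  proof -
    have a: "fst l \<in> A" "fst l' \<in> A" using l l' by (auto simp: L_def)
    have d: "fst l * cj (x - y) = x - y" "fst l' * cj (x - y) = x - y"
      using reflect_diff[of l x y] reflect_diff[of l' x y] assms l l' by auto
    have "N (x - y) \<noteq> 0"
    proof
      assume "N (x - y) = 0"
      then have "(x - y) * (x - y) = 0"
        using d(1) unfolding N_def by (metis mult.commute mult.left_commute mult_zero_right)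
      then show False using reduced[of "x - y"] assms by (simp add: closed)
    qed
    then have "fst l = fst l'"
      using cancel[of "cj (x - y)" "fst l" "fst l'"] d a assms
      by (simp add: closed N_cj mult.commute[of "cj _"])
    moreover from this have "snd l = snd l'"
      using l l' unfolding reflect_def by (metis add_left_cancel)
    ultimately show ?thesis by (simp add: prod_eq_iff)
  qed
  then show ?thesis by (intro card_le_Suc0_iff_eq[THEN iffD2, simplified One_nat_def[symmetric]])
      (auto simp: finite_L)
qed

text \<open>There are \<open>\<kappa> * q\<close> lines and each point lies on
  \<open>\<kappa>\<close> of them, so \<open>card E / q\<close> is the mean. Two points share at
  most one line, which bounds the second moment by n^2 + n * \<open>\<kappa>\<close>, where n is
  \<open>card E\<close>.\<close>

lemma axis_variance:
  "(\<Sum>l\<in>L. (real (card (axis l)) - real (card E) / real q)\<^sup>2) \<le> 3 * real q * real (card E)"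
proof -
  let ?n = "real (card E)"
  have q: "real q > 0" using q_ge by simp
  have 1: "(\<Sum>l\<in>L. real (card (axis l))) = ?n * real \<kappa>"
    using sum_card_relation[OF finite_E finite_L, of "\<lambda>x l. reflect l x = x"] E_in_A
    by (simp add: axis_def card_lines_through)
  have "(\<Sum>l\<in>L. (real (card (axis l)))\<^sup>2)
      = (\<Sum>x\<in>E. \<Sum>y\<in>E. real (card {l \<in> L. reflect l x = x \<and> reflect l y = y}))"
    using sum_card_relation_square[OF finite_E finite_L, of "\<lambda>x l. reflect l x = x"] by (simp add: axis_def)
  also have "\<dots> \<le> (\<Sum>x\<in>E. \<Sum>y\<in>E. 1 + (if x = y then real \<kappa> else 0))"
    using card_lines_through card_lines_through_two E_in_A by (intro sum_mono) auto
  also have "\<dots> = ?n\<^sup>2 + ?n * real \<kappa>"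
    using finite_E by (simp add: sum.distrib power2_eq_square algebra_simps)
  finally have 2: "(\<Sum>l\<in>L. (real (card (axis l)))\<^sup>2) \<le> ?n\<^sup>2 + ?n * real \<kappa>" .
  have "(\<Sum>l\<in>L. (real (card (axis l)) - ?n / real q)\<^sup>2)
      \<le> ?n\<^sup>2 + ?n * real \<kappa> - 2 * (?n / real q) * (?n * real \<kappa>) + real (\<kappa> * q) * (?n / real q)\<^sup>2"
    unfolding sum_centered_square card_L 1 using 2 by simp
  \<comment> \<open>The terms quadratic in \<open>?n\<close> cancel up to the factor
    \<open>q - \<kappa>\<close>, which is at most 1 by \<open>kappa_ge\<close>.\<close>
  also have "\<dots> = ?n * real \<kappa> + ?n\<^sup>2 / real q * (real q - real \<kappa>)"
    using q by (simp add: field_simps power2_eq_square)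
  also have "\<dots> \<le> ?n * (real q + 1) + ?n\<^sup>2 / real q * 1"
    using kappa_le kappa_ge q_ge by (intro add_mono mult_left_mono) auto
  also have "?n\<^sup>2 / real q \<le> ?n * real q"
    using mult_left_mono[OF card_E_le, of ?n] q by (simp add: field_simps power2_eq_square)
  also have "?n * (real q + 1) + ?n * real q * 1 \<le> 3 * real q * ?n"
  proof -
    have "?n * 1 \<le> ?n * real q" using q_ge by (intro mult_left_mono) auto
    then show ?thesis by (simp add: algebra_simps)
  qed
  finally show ?thesis by simp
qed

definition isosceles :: "('a \<times> 'a \<times> 'a) set"
  where "isosceles = {(x, y, z). x \<in> E \<and> y \<in> E \<and> z \<in> E \<and> N (x - y) = N (x - z) \<and> N (x - y) \<noteq> 0}"

text \<open>The square counts the triangles with \<open>y = z\<close>. In the others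
  \<open>y\<close> and \<open>z\<close> lie on a circle of nonzero radius about \<open>x\<close>, so
  \<open>y - z\<close> is anisotropic and the apex lies on the bisector of \<open>y\<close> and
  \<open>z\<close>.\<close>

lemma card_isosceles_le:
  "real (card isosceles)
    \<le> (real (card E))\<^sup>2 + (\<Sum>l\<in>L. real (card (mirrored l)) * real (card (axis l)))"
proof -
  let ?D = "(\<lambda>(x, y). (x, y, y)) ` (E \<times> E)"
  let ?B = "(\<lambda>(l, p, x). (x, p)) ` (SIGMA l:L. mirrored l \<times> axis l)"
  have sub: "isosceles \<subseteq> ?D \<union> ?B"
  proof
    fix w assume "w \<in> isosceles"
    then obtain x y z where w: "w = (x, y, z)" and xyz: "x \<in> E" "y \<in> E" "z \<in> E"
      and d: "N (x - y) = N (x - z)" "N (x - y) \<noteq> 0" by (auto simp: isosceles_def)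
    show "w \<in> ?D \<union> ?B"
    proof (cases "y = z")
      case True
      then show ?thesis using w xyz by auto
    next
      case False
      have a: "x \<in> A" "y \<in> A" "z \<in> A" using xyz E_in_A by auto
      have nz: "N (y - z) \<noteq> 0"
        using isotropic_difference_eq_0[of "x - y" "y - z"] d a False by (auto simp: closed)
      obtain l where l: "l \<in> L" "reflect l y = z" "reflect l x = x"
        using bisector_exists[OF a(2,3) nz] a d by auto
      then have "(l, (y, z), x) \<in> (SIGMA l:L. mirrored l \<times> axis l)"
        using xyz nz by (simp add: mirrored_def axis_def)
      then show ?thesis using w by force
    qed
  qed
  have fin: "finite (SIGMA l:L. mirrored l \<times> axis l)"
    by (simp add: finite_L finite_mirrored finite_axis)
  have "card isosceles \<le> card (?D \<union> ?B)"
    using fin finite_E by (intro card_mono sub) auto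
  also have "\<dots> \<le> card ?D + card ?B" by (rule card_Un_le)
  also have "\<dots> \<le> card (E \<times> E) + card (SIGMA l:L. mirrored l \<times> axis l)"
    using fin finite_E by (intro add_mono card_image_le) auto
  also have "\<dots> = card E ^ 2 + (\<Sum>l\<in>L. card (mirrored l) * card (axis l))"
    by (simp add: finite_L finite_mirrored finite_axis card_cartesian_product power2_eq_square)
  finally have "real (card isosceles) \<le> real (card E ^ 2 + (\<Sum>l\<in>L. card (mirrored l) * card (axis l)))"
    by (rule of_nat_mono)
  then show ?thesis by simp
qed

lemma mirrored_unique:
  assumes "l \<in> L" "l' \<in> L" "p \<in> mirrored l" "p \<in> mirrored l'"
  shows "l = l'"
  using assms reflection_unique[of l l' "fst p" "snd p"] by (auto simp: mirrored_def E_in_A)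

text \<open>Each ordered pair of points is counted for at most one reflection.\<close>

lemma sum_mirrored_le: "(\<Sum>l\<in>L. real (card (mirrored l))) \<le> (real (card E))\<^sup>2"
proof -
  have "inj_on snd (SIGMA l:L. mirrored l)"
    by (intro inj_onI) (use mirrored_unique in force)
  then have "card (SIGMA l:L. mirrored l) = card (snd ` (SIGMA l:L. mirrored l))"
    by (simp add: card_image)
  also have "\<dots> \<le> card (E \<times> E)" using finite_E by (intro card_mono) (auto simp: mirrored_def)
  finally have "(\<Sum>l\<in>L. card (mirrored l)) \<le> card E ^ 2"
    by (simp add: finite_L finite_mirrored card_cartesian_product power2_eq_square)
  then have "real (\<Sum>l\<in>L. card (mirrored l)) \<le> real (card E ^ 2)" by (rule of_nat_mono)
  then show ?thesis by simp
qed

section \<open>Congruent segments exchanged by a reflection\<close>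

definition V :: "'a \<Rightarrow> ('a \<times> 'a) set" where "V r = {(a, s). a \<in> E \<and> s \<in> S r \<and> a - s \<in> E}"

text \<open>For \<open>N s = N s'\<close> this says that some reflection in \<open>L\<close> maps \<open>a\<close> to \<open>b\<close> and \<open>a - s\<close> to \<open>b - s'\<close>.\<close>

definition adj :: "'a \<times> 'a \<Rightarrow> 'a \<times> 'a \<Rightarrow> bool"
  where "adj v w \<longleftrightarrow> cj (snd v) * (fst w - fst v) + snd w * cj (fst w - fst v) = 0"

lemma V_subset: "V r \<subseteq> E \<times> S r"
  by (auto simp: V_def)

lemma finite_V: "finite (V r)"
  using V_subset by (rule finite_subset) (simp add: finite_E finite_S)

lemma card_V: "card (V r) = \<nu> r"
proof -
  have "bij_betw (\<lambda>(a, s). (a, a - s)) (V r) {(x, y). x \<in> E \<and> y \<in> E \<and> N (x - y) = r}"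
    by (rule bij_betwI[where g = "\<lambda>(a, s). (a, a - s)"]) (auto simp: V_def S_def E_in_A closed)
  then show ?thesis by (simp add: \<nu>_def bij_betw_same_card)
qed

text \<open>Dividing by \<open>cj s\<close> turns the condition on \<open>t = b - a\<close> into the
  axis equation for \<open>u = s' / cj s\<close>, which has norm \<open>e\<close>. This is why
  segments are stored as an endpoint and a vector: for fixed vectors the other endpoint runs through
  a line.\<close>

lemma card_adj_second:
  assumes r: "r \<in> G" and a: "a \<in> A" and s: "s \<in> S r" "s' \<in> S r"
  shows "card {b \<in> A. adj (a, s) (b, s')} = q"
proof -
  have sA: "s \<in> A" "s' \<in> A" "cj s \<in> A" "N s = r" "N s' = r" using s by (auto simp: S_def closed)
  have nz: "N (cj s) \<noteq> 0" using r sA by (auto simp: N_cj G_def)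
  define i where "i = iv (cj s)"
  have i: "i \<in> A" "cj s * i = e" using iv[OF sA(3) nz] by (auto simp: i_def)
  define u where "u = s' * i"
  have u: "u \<in> A" using sA i by (simp add: u_def closed)
  have "N u = N s' * N i" using sA i by (simp add: u_def N_mult)
  also have "\<dots> = N (cj s * i)" using sA i(1) by (simp add: N_mult N_cj)
  finally have "N u = e" using i by (simp add: N_unit)
  then have c: "card {t \<in> A. t + u * cj t = 0} = q" using card_axis[OF u] by (simp add: N_def)
  have iff: "cj s * t + s' * cj t = 0 \<longleftrightarrow> t + u * cj t = 0" if t: "t \<in> A" for t
  proof -
    have su: "cj s * u = s'" using i sA unfolding u_def by (metis mult.left_commute mult_unit)
    have "cj s * (t + u * cj t) = cj s * t + s' * cj t"
      using su by (simp add: distrib_left flip: mult.assoc)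
    then show ?thesis
      using cancel_zero[of "cj s" "t + u * cj t"] nz sA u t by (auto simp: closed)
  qed
  have "bij_betw (\<lambda>b. b - a) {b \<in> A. adj (a, s) (b, s')} {t \<in> A. t + u * cj t = 0}"
    by (rule bij_betwI[where g = "\<lambda>t. t + a"]) (auto simp: adj_def a closed iff)
  then show ?thesis using c by (simp add: bij_betw_same_card)
qed

lemma card_adj:
  assumes r: "r \<in> G" and v: "v \<in> V r"
  shows "card {w \<in> A \<times> S r. adj v w} = \<kappa> * q"
proof -
  obtain a s where v': "v = (a, s)" "a \<in> A" "s \<in> S r" using v by (auto simp: V_def E_in_A)
  show ?thesis using v' r
    by (simp add: card_Times_filter finite_A finite_S card_adj_second card_S)
qed

text \<open>Fix the second vector \<open>c\<close>. Subtracting the two conditions eliminates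
  \<open>cj b\<close> and leaves a linear equation for \<open>b\<close> with coefficient
  \<open>cj (s' - s)\<close>, which is anisotropic because \<open>s\<close> and \<open>s'\<close>
  lie on one circle. So each of the \<open>\<kappa>\<close> choices of \<open>c\<close> admits at
  most one \<open>b\<close>.\<close>

lemma card_common_adj_distinct:
  assumes r: "r \<in> G" and a: "a \<in> A" "a' \<in> A" and s: "s \<in> S r" "s' \<in> S r" "s \<noteq> s'"
  shows "card {w \<in> A \<times> S r. adj (a, s) w \<and> adj (a', s') w} \<le> \<kappa>"
proof -
  have sA: "s \<in> A" "s' \<in> A" "N s = r" "N s' = r" "r \<noteq> 0" using s r by (auto simp: S_def G_def)
  have "N (s' - s) \<noteq> 0"
    using isotropic_difference_eq_0[of s "s' - s"] sA s by (auto simp: closed)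
  then have nz: "N (cj (s' - s)) \<noteq> 0" using sA by (simp add: N_cj closed)
  have "card {b \<in> A. adj (a, s) (b, c) \<and> adj (a', s') (b, c)} \<le> 1" if "c \<in> S r" for c
  proof -
    have "b = b'" if b: "b \<in> A" "adj (a, s) (b, c)" "adj (a', s') (b, c)"
      and b': "b' \<in> A" "adj (a, s) (b', c)" "adj (a', s') (b', c)" for b b'
    proof -
      have "cj (s' - s) * (b - b')
        = (cj s' * (b - a') + c * cj (b - a')) - (cj s' * (b' - a') + c * cj (b' - a'))
        - ((cj s * (b - a) + c * cj (b - a)) - (cj s * (b' - a) + c * cj (b' - a)))"
        using b b' a sA by (simp add: cj_diff algebra_simps)
      then have "cj (s' - s) * (b - b') = 0" using b b' by (simp add: adj_def)
      then show ?thesis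
        using cancel_zero[of "cj (s' - s)" "b - b'"] nz sA b b' by (simp add: closed)
    qed
    then show ?thesis
      by (intro card_le_Suc0_iff_eq[THEN iffD2, simplified One_nat_def[symmetric]])
        (auto simp: finite_A)
  qed
  then have "(\<Sum>c\<in>S r. card {b \<in> A. adj (a, s) (b, c) \<and> adj (a', s') (b, c)}) \<le> (\<Sum>c\<in>S r. 1)"
    by (rule sum_mono)
  then show ?thesis using r by (simp add: card_Times_filter finite_A finite_S card_S)
qed

text \<open>Now subtraction eliminates \<open>b\<close> and leaves
  \<open>cj s * \<delta> + c * cj \<delta> = 0\<close> for \<open>\<delta> = a' - a\<close>, which
  determines \<open>c\<close>. The endpoint \<open>b\<close> is still free on a line of
  \<open>q\<close> points.\<close>

lemma card_common_adj_parallel: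
  assumes r: "r \<in> G" and a: "a \<in> A" "a' \<in> A" "a \<noteq> a'" and s: "s \<in> S r"
  shows "card {w \<in> A \<times> S r. adj (a, s) w \<and> adj (a', s) w} \<le> q"
proof (cases "{w \<in> A \<times> S r. adj (a, s) w \<and> adj (a', s) w} = {}")
  case False
  define \<delta> where "\<delta> = a' - a"
  have sA: "s \<in> A" "N s \<noteq> 0" "\<delta> \<in> A" using s r a by (auto simp: S_def G_def \<delta>_def closed)
  have key: "cj s * \<delta> + c * cj \<delta> = 0"
    if "b \<in> A" "c \<in> S r" "adj (a, s) (b, c)" "adj (a', s) (b, c)" for b c
  proof -
    have "cj s * \<delta> + c * cj \<delta> =
      (cj s * (b - a) + c * cj (b - a)) - (cj s * (b - a') + c * cj (b - a'))"
      using that a sA by (simp add: \<delta>_def cj_diff algebra_simps)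
    then show ?thesis using that by (simp add: adj_def)
  qed
  \<comment> \<open>One common neighbour is needed to see that \<open>\<delta>\<close> is
    anisotropic: multiplying its equation by an isotropic \<open>\<delta>\<close> would give
    \<open>\<delta> * \<delta> = 0\<close>.\<close>
  from False obtain b0 c0 where 0: "b0 \<in> A" "c0 \<in> S r" "adj (a, s) (b0, c0)" "adj (a', s) (b0, c0)"
    by auto
  have "N \<delta> \<noteq> 0"
  proof
    assume "N \<delta> = 0"
    then have \<delta>0: "\<delta> * cj \<delta> = 0" by (simp add: N_def)
    have "(cj s * \<delta> + c0 * cj \<delta>) * \<delta> = 0" using key[OF 0] by simp
    then have "cj s * (\<delta> * \<delta>) + c0 * (\<delta> * cj \<delta>) = 0" by (simp add: algebra_simps)
    then have "\<delta> * \<delta> = 0"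
      using \<delta>0 cancel_zero[of "cj s" "\<delta> * \<delta>"] sA by (simp add: closed N_cj)
    then show False using reduced[OF sA(3)] a by (simp add: \<delta>_def)
  qed
  then have nz: "N (cj \<delta>) \<noteq> 0" using sA by (simp add: N_cj)
  have "c = c0" if "b \<in> A" "c \<in> S r" "adj (a, s) (b, c)" "adj (a', s) (b, c)" for b c
  proof -
    have "cj \<delta> * c = cj \<delta> * c0"
      using key[OF that] key[OF 0] by (metis add_left_cancel mult.commute)
    then show ?thesis using cancel[of "cj \<delta>" c c0] nz sA that 0 by (simp add: closed S_def)
  qed
  then have "{w \<in> A \<times> S r. adj (a, s) w \<and> adj (a', s) w} \<subseteq> {b \<in> A. adj (a, s) (b, c0)} \<times> {c0}"
    by force
  then have "card {w \<in> A \<times> S r. adj (a, s) w \<and> adj (a', s) w} \<le> card ({b \<in> A. adj (a, s) (b, c0)} \<times> {c0})"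
    by (intro card_mono) (auto simp: finite_A)
  also have "\<dots> = q" using card_adj_second[OF r a(1) s 0(2)] by (simp add: card_cartesian_product)
  finally show ?thesis .
qed (simp only: card.empty le0)

text \<open>A mixing bound for \<open>adj\<close> between \<open>V r\<close> and all of
  \<open>A \<times> S r\<close>: the mean degree is \<open>\<nu> r / q\<close>, and the common
  neighbour counts bound the variance. Taking the indicator of \<open>V r\<close> as weight gives
  the expected number of pairs plus an error.\<close>

lemma card_adj_pairs_le:
  assumes r: "r \<in> G"
  shows "real (card {(v, w). v \<in> V r \<and> w \<in> V r \<and> adj v w}) \<le> (real (\<nu> r))\<^sup>2 / real q + 2 * real q * real (\<nu> r)"
proof -
  let ?W = "A \<times> S r" and ?\<nu> = "real (\<nu> r)" and ?q = "real q"
  define d where "d w = real (card {v \<in> V r. adj v w})" for w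
  have q: "?q \<ge> 3" using q_ge by simp
  have fW: "finite ?W" by (simp add: finite_A finite_S)
  have sub: "V r \<subseteq> ?W" using V_subset E_in_A by blast
  have 1: "(\<Sum>w\<in>?W. d w) = ?\<nu> * (real \<kappa> * ?q)"
    using sum_card_relation[OF finite_V[of r] fW, of adj] card_adj[OF r] card_V[of r] by (simp add: d_def)
  have cV: "real (card {v' \<in> V r. snd v' = snd v}) \<le> real (card E)" for v
  proof -
    have "card {v' \<in> V r. snd v' = snd v} \<le> card (E \<times> {snd v})"
      using finite_E by (intro card_mono) (auto simp: V_def)
    then show ?thesis by (simp add: card_cartesian_product)
  qed
  have "(\<Sum>w\<in>?W. (d w)\<^sup>2) = (\<Sum>v\<in>V r. \<Sum>v'\<in>V r. real (card {w \<in> ?W. adj v w \<and> adj v' w}))"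
    using sum_card_relation_square[OF finite_V[of r] fW, of adj] by (simp add: d_def)
  \<comment> \<open>For parallel segments the bound \<open>q\<close> may exceed
    \<open>\<kappa>\<close>, but by at most 1; the indicator pays for this. A segment has at most
    \<open>card E\<close> parallels, by \<open>cV\<close>.\<close>
  also have "\<dots> \<le> (\<Sum>v\<in>V r. \<Sum>v'\<in>V r. real \<kappa> + of_bool (snd v' = snd v) + (if v = v' then real \<kappa> * ?q else 0))"
  proof (intro sum_mono)
    fix v v' assume v: "v \<in> V r" and v': "v' \<in> V r"
    obtain a s a' s' where d: "v = (a, s)" "v' = (a', s')" "a \<in> A" "a' \<in> A" "s \<in> S r" "s' \<in> S r"
      using v v' by (auto simp: V_def E_in_A)
    consider "v = v'" | "s = s'" "a \<noteq> a'" | "s \<noteq> s'" using d by auto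
    then show "real (card {w \<in> ?W. adj v w \<and> adj v' w})
      \<le> real \<kappa> + of_bool (snd v' = snd v) + (if v = v' then real \<kappa> * ?q else 0)"
    proof cases
      case 1
      then show ?thesis using card_adj[OF r v] by simp
    next
      case 2
      then show ?thesis using card_common_adj_parallel[OF r d(3,4) _ d(5)] d kappa_ge q_ge by simp
    next
      case 3
      then show ?thesis using card_common_adj_distinct[OF r d(3-6)] d by simp
    qed
  qed
  also have "\<dots> = real \<kappa> * ?\<nu>\<^sup>2 + (\<Sum>v\<in>V r. real (card {v' \<in> V r. snd v' = snd v})) + ?\<nu> * (real \<kappa> * ?q)"
    by (simp add: sum.distrib finite_V card_V card_filter_eq_sum power2_eq_square algebra_simps)
  also have "\<dots> \<le> real \<kappa> * ?\<nu>\<^sup>2 + ?\<nu> * real (card E) + ?\<nu> * (real \<kappa> * ?q)"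
    using sum_mono[of "V r" "\<lambda>v. real (card {v' \<in> V r. snd v' = snd v})" "\<lambda>_. real (card E)", OF cV]
    by (simp add: card_V)
  finally have 2: "(\<Sum>w\<in>?W. (d w)\<^sup>2) \<le> real \<kappa> * ?\<nu>\<^sup>2 + ?\<nu> * real (card E) + ?\<nu> * (real \<kappa> * ?q)" .
  have cW: "real (card ?W) = ?q\<^sup>2 * real \<kappa>"
    by (simp add: card_cartesian_product card_A card_S[OF r])
  have "(\<Sum>w\<in>?W. (d w - ?\<nu> / ?q)\<^sup>2)
    \<le> real \<kappa> * ?\<nu>\<^sup>2 + ?\<nu> * real (card E) + ?\<nu> * (real \<kappa> * ?q) - 2 * (?\<nu> / ?q) * (?\<nu> * (real \<kappa> * ?q)) + ?q\<^sup>2 * real \<kappa> * (?\<nu> / ?q)\<^sup>2"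
    unfolding sum_centered_square 1 cW using 2 by simp
  \<comment> \<open>The three terms quadratic in \<open>?\<nu>\<close> have coefficients 1, -2 and 1
    times \<open>\<kappa>\<close> and cancel exactly.\<close>
  also have "\<dots> = ?\<nu> * (real (card E) + real \<kappa> * ?q)"
    using q by (simp add: field_simps power2_eq_square)
  also have "\<dots> \<le> ?\<nu> * (2 * ?q)\<^sup>2"
  proof (intro mult_left_mono)
    have "real \<kappa> * ?q \<le> (?q + 1) * ?q" using kappa_le by (intro mult_right_mono) auto
    moreover have "?q * 1 \<le> ?q * ?q" using q by (intro mult_left_mono) auto
    ultimately show "real (card E) + real \<kappa> * ?q \<le> (2 * ?q)\<^sup>2"
      using card_E_le by (simp add: power2_eq_square algebra_simps)
  qed simp
  finally have 3: "(\<Sum>w\<in>?W. (d w - ?\<nu> / ?q)\<^sup>2) \<le> ?\<nu> * (2 * ?q)\<^sup>2" .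
  have "{(v, w). v \<in> V r \<and> w \<in> V r \<and> adj v w} = {v \<in> V r \<times> V r. adj (fst v) (snd v)}" by auto
  then have "real (card {(v, w). v \<in> V r \<and> w \<in> V r \<and> adj v w}) = (\<Sum>w\<in>V r. d w)"
    by (simp add: card_Times_filter finite_V d_def)
  also have "\<dots> = (\<Sum>w\<in>?W. of_bool (w \<in> V r) * d w)"
    using fW sub by (simp add: sum.If_cases of_bool_def if_distrib[of "\<lambda>x. x * _"] Int_absorb1 cong: if_cong)
  also have "\<dots> \<le> ?\<nu> / ?q * (\<Sum>w\<in>?W. of_bool (w \<in> V r))
      + sqrt ((\<Sum>w\<in>?W. (of_bool (w \<in> V r))\<^sup>2) * (\<Sum>w\<in>?W. (d w - ?\<nu> / ?q)\<^sup>2))"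
    by (rule sum_mult_le_centered)
  also have "(\<Sum>w\<in>?W. of_bool (w \<in> V r)) = ?\<nu>"
    using fW sub by (simp add: sum_of_bool_eq Int_absorb1 card_V)
  also have "(\<Sum>w\<in>?W. (of_bool (w \<in> V r))\<^sup>2) = ?\<nu>"
    using fW sub by (simp add: sum_of_bool_eq Int_absorb1 card_V power2_eq_square flip: of_bool_conj)
  also have "sqrt (?\<nu> * (\<Sum>w\<in>?W. (d w - ?\<nu> / ?q)\<^sup>2)) \<le> sqrt (?\<nu> * (?\<nu> * (2 * ?q)\<^sup>2))"
    using 3 by (intro real_sqrt_le_mono mult_left_mono) auto
  also have "\<dots> = 2 * ?q * ?\<nu>"
    by (simp add: real_sqrt_mult)
  finally show ?thesis by (simp add: power2_eq_square)
qed

text \<open>A reflection mapping \<open>a\<close> to \<open>b\<close> and \<open>c\<close> to \<open>d\<close> forces \<open>N (a - c) = N (b - d)\<close>, so the pairs of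
  mirrored pairs are counted according to this common value.\<close>

lemma sum_mirrored_square_le:
  "(\<Sum>l\<in>L. (real (card (mirrored l)))\<^sup>2)
    \<le> (\<Sum>r\<in>G. (real (\<nu> r))\<^sup>2) / real q + 4 * real q * (real (card E))\<^sup>2"
proof -
  let ?q = "real q" and ?n = "real (card E)"
  let ?Q = "SIGMA l:L. mirrored l \<times> mirrored l"
  \<comment> \<open>The pairs with \<open>N (fst p - fst p') = 0\<close> belong to no
    \<open>V r\<close> with \<open>r \<in> G\<close> and are bounded separately: the first pair
    determines the reflection, there are fewer than \<open>2 * q\<close> isotropic choices for the
    difference, and the last point is then forced.\<close>
  define Q0 where "Q0 = {(l, p, p') \<in> ?Q. N (fst p - fst p') = 0}"
  define Q1 where "Q1 = {(l, p, p') \<in> ?Q. N (fst p - fst p') \<noteq> 0}"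
  define M where "M r = {(v, w). v \<in> V r \<and> w \<in> V r \<and> adj v w}" for r
  let ?Z = "{z \<in> A. N z = 0}"
  have fQ: "finite ?Q" by (simp add: finite_L finite_mirrored)
  have fM: "finite (M r)" for r
    by (rule finite_subset[of _ "V r \<times> V r"]) (auto simp: M_def finite_V)
  have Q0: "card Q0 \<le> card (E \<times> E \<times> ?Z)"
  proof (rule card_inj_on_le)
    let ?f = "\<lambda>(l :: 'a \<times> 'a, p :: 'a \<times> 'a, p' :: 'a \<times> 'a). (fst p, snd p, fst p - fst p')"
    show "inj_on ?f Q0"
    proof (rule inj_onI)
      fix x y assume xy: "x \<in> Q0" "y \<in> Q0" "?f x = ?f y"
      obtain l a b c d where x: "x = (l, (a, b), (c, d))" by (metis surj_pair)
      obtain l' a' b' c' d' where y: "y = (l', (a', b'), (c', d'))" by (metis surj_pair)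
      have 1: "a = a'" "b = b'" "c = c'" using xy x y by auto
      then have "l = l'" using xy x y mirrored_unique[of l l' "(a, b)"] by (simp add: Q0_def)
      moreover from this have "d = d'" using xy x y 1 by (auto simp: Q0_def mirrored_def)
      ultimately show "x = y" using x y 1 by simp
    qed
    show "?f ` Q0 \<subseteq> E \<times> E \<times> ?Z" by (auto simp: Q0_def mirrored_def E_in_A closed)
    show "finite (E \<times> E \<times> ?Z)" by (simp add: finite_E finite_A)
  qed
  have "card ?Z \<le> 2 * q - 1" using card_isotropic by (simp add: N_def)
  then have "card ?Z \<le> 2 * q" by simp
  then have "card (E \<times> E \<times> ?Z) \<le> card E * (card E * (2 * q))"
    unfolding card_cartesian_product by (intro mult_left_mono) auto
  with Q0 have "card Q0 \<le> card E * (card E * (2 * q))" by linarith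
  then have "real (card Q0) \<le> real (card E * (card E * (2 * q)))" by (rule of_nat_mono)
  then have Q0': "real (card Q0) \<le> 2 * ?q * ?n\<^sup>2" by (simp add: power2_eq_square mult_ac)
  have Q1: "card Q1 \<le> card (SIGMA r:G. M r)"
  proof (rule card_inj_on_le)
    let ?f = "\<lambda>(l :: 'a \<times> 'a, p, p'). (N (fst p - fst p'), (fst p, fst p - fst p'), (snd p, snd p - snd p'))"
    show "inj_on ?f Q1"
    proof (rule inj_onI)
      fix x y assume xy: "x \<in> Q1" "y \<in> Q1" "?f x = ?f y"
      obtain l a b c d where x: "x = (l, (a, b), (c, d))" by (metis surj_pair)
      obtain l' a' b' c' d' where y: "y = (l', (a', b'), (c', d'))" by (metis surj_pair)
      have 1: "a = a'" "b = b'" "c = c'" "d = d'" using xy x y by auto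
      then have "l = l'" using xy x y mirrored_unique[of l l' "(a, b)"] by (simp add: Q1_def)
      then show "x = y" using x y 1 by simp
    qed
    show "?f ` Q1 \<subseteq> (SIGMA r:G. M r)"
    proof
      fix y assume "y \<in> ?f ` Q1"
      then obtain l a b c d where y: "y = ?f (l, (a, b), (c, d))" and x: "(l, (a, b), (c, d)) \<in> Q1"
        by force
      then have l: "l \<in> L" and E: "a \<in> E" "b \<in> E" "c \<in> E" "d \<in> E"
        and m: "reflect l a = b" "reflect l c = d" and nz: "N (a - c) \<noteq> 0"
        by (auto simp: Q1_def mirrored_def)
      have A: "a \<in> A" "b \<in> A" "c \<in> A" "d \<in> A" using E E_in_A by auto
      obtain u where u: "u \<in> A" "N u = e" "u = fst l" using l by (auto simp: L_def)
      have bd: "b - d = u * cj (a - c)" using reflect_diff[OF l A(1,3)] m u by simp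
      have "reflect l b = a" using reflect_reflect[OF l A(1)] m by simp
      then have ab: "a - b = u * cj (b - a)" using reflect_diff[OF l A(2,1)] m u by simp
      have "N (b - d) = N (a - c)"
        unfolding bd using u(1,2) A N_mult[of u "cj (a - c)"] by (simp add: N_cj closed unit_mult N_closed)
      moreover have z: "(b - a) + u * cj (b - a) = 0" unfolding ab[symmetric] by simp
      \<comment> \<open>The condition \<open>adj\<close> factors through the equation
        \<open>a - b = u * cj (b - a)\<close>, which holds because the reflection interchanges
        \<open>a\<close> and \<open>b\<close>.\<close>
      have "cj (a - c) * (b - a) + (b - d) * cj (b - a) = cj (a - c) * ((b - a) + u * cj (b - a))"
        unfolding bd by (simp add: distrib_left mult_ac)
      then have "adj (a, a - c) (b, b - d)" unfolding z by (simp add: adj_def)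
      ultimately show "y \<in> (SIGMA r:G. M r)"
        using E A nz by (auto simp: y M_def V_def S_def closed N_in_G)
    qed
    show "finite (SIGMA r:G. M r)" by (simp add: finite_G fM)
  qed
  have "real (card Q1) \<le> real (card (SIGMA r:G. M r))" using Q1 by (rule of_nat_mono)
  also have "\<dots> = (\<Sum>r\<in>G. real (card (M r)))" by (simp add: finite_G fM)
  also have "\<dots> \<le> (\<Sum>r\<in>G. (real (\<nu> r))\<^sup>2 / ?q + 2 * ?q * real (\<nu> r))"
    unfolding M_def by (intro sum_mono card_adj_pairs_le)
  also have "\<dots> = (\<Sum>r\<in>G. (real (\<nu> r))\<^sup>2) / ?q + 2 * ?q * (\<Sum>r\<in>G. real (\<nu> r))"
    by (simp add: sum.distrib sum_divide_distrib sum_distrib_left)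
  also have "(\<Sum>r\<in>G. real (\<nu> r)) \<le> ?n\<^sup>2"
  proof -
    have "(\<Sum>r\<in>G. \<nu> r) = card (\<Union>r\<in>G. {(x, y). x \<in> E \<and> y \<in> E \<and> N (x - y) = r})"
      unfolding \<nu>_def
    proof (rule card_UN_disjoint[symmetric])
      have "finite {(x, y). x \<in> E \<and> y \<in> E \<and> N (x - y) = r}" for r
        by (rule finite_subset[of _ "E \<times> E"]) (auto simp: finite_E)
      then show "\<forall>r\<in>G. finite {(x, y). x \<in> E \<and> y \<in> E \<and> N (x - y) = r}" by blast
    qed (auto simp: finite_G)
    also have "\<dots> \<le> card (E \<times> E)" by (intro card_mono) (auto simp: finite_E)
    finally have "real (\<Sum>r\<in>G. \<nu> r) \<le> real (card (E \<times> E))" by (rule of_nat_mono)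
    then show ?thesis by (simp add: card_cartesian_product power2_eq_square)
  qed
  finally have Q1': "real (card Q1) \<le> (\<Sum>r\<in>G. (real (\<nu> r))\<^sup>2) / ?q + 2 * ?q * ?n\<^sup>2"
    by (simp add: mult_left_mono)
  have "?Q = Q0 \<union> Q1" by (auto simp: Q0_def Q1_def)
  then have "card ?Q \<le> card Q0 + card Q1" using card_Un_le by simp
  then have "real (card ?Q) \<le> real (card Q0 + card Q1)" by (rule of_nat_mono)
  moreover have "real (card ?Q) = (\<Sum>l\<in>L. (real (card (mirrored l)))\<^sup>2)"
    by (simp add: finite_L finite_mirrored card_cartesian_product power2_eq_square)
  ultimately show ?thesis using Q0' Q1' by (simp add: algebra_simps)
qed

text \<open>Split \<open>\<nu> r\<close> according to the first point of the pair and apply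
  Cauchy-Schwarz over that point. The squares of the parts count isosceles triangles with the point
  as apex.\<close>

lemma sum_\<nu>_square_le_isosceles:
  "(\<Sum>r\<in>G. (real (\<nu> r))\<^sup>2) \<le> real (card E) * real (card isosceles)"
proof -
  define m where "m r x = card {y \<in> E. N (x - y) = r}" for r x
  have fin: "finite {p \<in> E \<times> E. N (x - fst p) = N (x - snd p) \<and> N (x - fst p) \<noteq> 0}" for x
    using finite_E by simp
  have \<nu>: "\<nu> r = (\<Sum>x\<in>E. m r x)" for r
  proof -
    have "{(x, y). x \<in> E \<and> y \<in> E \<and> N (x - y) = r} = (SIGMA x:E. {y \<in> E. N (x - y) = r})" by auto
    then show ?thesis by (simp add: \<nu>_def m_def finite_E)
  qed
  have mm: "(\<Sum>r\<in>G. (m r x)\<^sup>2) = card {p \<in> E \<times> E. N (x - fst p) = N (x - snd p) \<and> N (x - fst p) \<noteq> 0}"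
    if x: "x \<in> E" for x
  proof -
    have "(\<Sum>r\<in>G. (m r x)\<^sup>2) = card (\<Union>r\<in>G. {y \<in> E. N (x - y) = r} \<times> {y \<in> E. N (x - y) = r})"
      by (subst card_UN_disjoint) (auto simp: finite_G finite_E card_cartesian_product m_def power2_eq_square)
    also have "(\<Union>r\<in>G. {y \<in> E. N (x - y) = r} \<times> {y \<in> E. N (x - y) = r})
        = {p \<in> E \<times> E. N (x - fst p) = N (x - snd p) \<and> N (x - fst p) \<noteq> 0}"
      using x by (auto simp: N_in_G E_in_A closed G_def) (metis E_in_A N_in_G G_closed cj_N N_closed diff_closed)+
    finally show ?thesis .
  qed
  have "isosceles = (SIGMA x:E. {p \<in> E \<times> E. N (x - fst p) = N (x - snd p) \<and> N (x - fst p) \<noteq> 0})"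
    by (auto simp: isosceles_def)
  then have iso: "card isosceles = (\<Sum>x\<in>E. \<Sum>r\<in>G. (m r x)\<^sup>2)"
    using fin by (simp add: finite_E mm)
  have "(\<Sum>r\<in>G. (real (\<nu> r))\<^sup>2) \<le> (\<Sum>r\<in>G. real (card E) * (\<Sum>x\<in>E. (real (m r x))\<^sup>2))"
    unfolding \<nu> of_nat_sum by (intro sum_mono sum_square_le_card_sum_square)
  also have "\<dots> = real (card E) * (\<Sum>x\<in>E. \<Sum>r\<in>G. (real (m r x))\<^sup>2)"
    unfolding sum_distrib_left[symmetric] by (simp add: sum.swap[of _ G E])
  finally show ?thesis by (simp add: iso)
qed

text \<open>The weighted incidence bound with weights \<open>card (mirrored l)\<close> estimates the
  number \<open>?T\<close> of triangles. The second moment of these weights is itself bounded in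
  terms of \<open>?T\<close>, so the resulting inequality has to be solved for
  \<open>?T\<close>.\<close>

lemma sum_\<nu>_square_le:
  assumes n: "real (card E) \<ge> 4 * real q"
  shows "(\<Sum>r\<in>G. (real (\<nu> r))\<^sup>2)
    \<le> 4 * real (card E) ^ 4 / real q + 8 * real q * (real (card E))\<^sup>2 * sqrt (real (card E))"
proof -
  let ?n = "real (card E)" and ?q = "real q" and ?T = "real (card isosceles)"
  let ?P = "\<Sum>r\<in>G. (real (\<nu> r))\<^sup>2"
  have q: "?q \<ge> 3" using q_ge by simp
  have n0: "?n > 0" using n q by linarith
  have P: "?P \<le> ?n * ?T" by (rule sum_\<nu>_square_le_isosceles)
  have "(\<Sum>l\<in>L. (real (card (mirrored l)))\<^sup>2) \<le> ?P / ?q + 4 * ?q * ?n\<^sup>2"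
    by (rule sum_mirrored_square_le)
  also have "\<dots> \<le> ?n * ?T / ?q + 4 * ?q * ?n\<^sup>2" using P q by (simp add: divide_right_mono)
  finally have Q: "(\<Sum>l\<in>L. (real (card (mirrored l)))\<^sup>2) \<le> ?n * ?T / ?q + 4 * ?q * ?n\<^sup>2" .
  have "(\<Sum>l\<in>L. (real (card (mirrored l)))\<^sup>2) * (\<Sum>l\<in>L. (real (card (axis l)) - ?n / ?q)\<^sup>2)
      \<le> (?n * ?T / ?q + 4 * ?q * ?n\<^sup>2) * (3 * ?q * ?n)"
    using Q axis_variance q by (intro mult_mono) (auto intro!: sum_nonneg)
  also have "\<dots> = ?T * (3 * ?n\<^sup>2) + 12 * ?q\<^sup>2 * ?n ^ 3"
    using q by (simp add: field_simps power2_eq_square power3_eq_cube)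
  finally have "sqrt ((\<Sum>l\<in>L. (real (card (mirrored l)))\<^sup>2) * (\<Sum>l\<in>L. (real (card (axis l)) - ?n / ?q)\<^sup>2))
      \<le> sqrt (?T * (3 * ?n\<^sup>2) + 12 * ?q\<^sup>2 * ?n ^ 3)" by (rule real_sqrt_le_mono)
  also have "\<dots> \<le> sqrt (?T * (3 * ?n\<^sup>2)) + sqrt (12 * ?q\<^sup>2 * ?n ^ 3)"
    by (intro sqrt_add_le_add_sqrt) auto
  \<comment> \<open>The arithmetic-geometric mean inequality leaves only half of \<open>?T\<close>
    on the right, which the left side absorbs below.\<close>
  also have "sqrt (?T * (3 * ?n\<^sup>2)) \<le> (?T + 3 * ?n\<^sup>2) / 2"
    by (intro arith_geo_mean_sqrt) auto
  \<comment> \<open>Rounding 12 up to 16 makes the root exact.\<close>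
  also have "sqrt (12 * ?q\<^sup>2 * ?n ^ 3) \<le> sqrt ((4 * ?q * ?n)\<^sup>2 * ?n)"
    by (intro real_sqrt_le_mono) (simp add: power2_eq_square power3_eq_cube mult_ac mult_right_mono)
  also have "\<dots> = 4 * ?q * ?n * sqrt ?n" by (simp add: real_sqrt_mult)
  finally have s: "sqrt ((\<Sum>l\<in>L. (real (card (mirrored l)))\<^sup>2) * (\<Sum>l\<in>L. (real (card (axis l)) - ?n / ?q)\<^sup>2))
      \<le> (?T + 3 * ?n\<^sup>2) / 2 + 4 * ?q * ?n * sqrt ?n" by simp
  have "?T \<le> ?n\<^sup>2 + (\<Sum>l\<in>L. real (card (mirrored l)) * real (card (axis l)))"
    by (rule card_isosceles_le)
  also have "(\<Sum>l\<in>L. real (card (mirrored l)) * real (card (axis l)))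
      \<le> ?n / ?q * (\<Sum>l\<in>L. real (card (mirrored l)))
        + sqrt ((\<Sum>l\<in>L. (real (card (mirrored l)))\<^sup>2) * (\<Sum>l\<in>L. (real (card (axis l)) - ?n / ?q)\<^sup>2))"
    by (rule sum_mult_le_centered)
  also have "?n / ?q * (\<Sum>l\<in>L. real (card (mirrored l))) \<le> ?n / ?q * ?n\<^sup>2"
    using q by (intro mult_left_mono sum_mirrored_le) auto
  finally have "?T \<le> ?n\<^sup>2 + (?n / ?q * ?n\<^sup>2 + ((?T + 3 * ?n\<^sup>2) / 2 + 4 * ?q * ?n * sqrt ?n))"
    using s by linarith
  then have T: "?T \<le> 5 * ?n\<^sup>2 + 2 * (?n ^ 3 / ?q) + 8 * ?q * ?n * sqrt ?n"
    by (simp add: field_simps power2_eq_square power3_eq_cube)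
  \<comment> \<open>The assumption on \<open>card E\<close> makes the term 5 * n^2 smaller than 2 *
    n^3 / q, so it merges with the main term.\<close>
  have "(4 * ?q) * ?n\<^sup>2 \<le> ?n * ?n\<^sup>2" using n by (intro mult_right_mono) auto
  then have "4 * ?n\<^sup>2 \<le> ?n ^ 3 / ?q"
    using q by (simp add: field_simps power2_eq_square power3_eq_cube)
  with T have "?T \<le> 4 * (?n ^ 3 / ?q) + 8 * ?q * ?n * sqrt ?n"
    using zero_le_power2[of ?n] by linarith
  then have "?n * ?T \<le> ?n * (4 * (?n ^ 3 / ?q) + 8 * ?q * ?n * sqrt ?n)"
    by (intro mult_left_mono) auto
  with P have "?P \<le> ?n * (4 * (?n ^ 3 / ?q) + 8 * ?q * ?n * sqrt ?n)" by linarith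
  also have "\<dots> = 4 * ?n ^ 4 / ?q + 8 * ?q * ?n\<^sup>2 * sqrt ?n"
    by (simp add: algebra_simps power2_eq_square power3_eq_cube power4_eq_xxxx)
  finally show ?thesis .
qed

end

section \<open>Circles of Apollonius and multiplicative convolution\<close>

context conj_plane
begin

lemma iv_unique:
  assumes "z \<in> A" "y \<in> A" "z * y = e" shows "iv z = y"
proof -
  have "N z * N y = e" using N_mult[of z y] assms by (simp add: N_unit)
  then have nz: "N z \<noteq> 0" using unit_nonzero by auto
  then show ?thesis using cancel[of z "iv z" y] iv[of z] assms by simp
qed

text \<open>\<open>K y y' \<rho>\<close> is a circle of Apollonius without the points isotropic to its foci.\<close>

definition K :: "'a \<Rightarrow> 'a \<Rightarrow> 'a \<Rightarrow> 'a set"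
  where "K y y' \<rho> = {x \<in> A. N (x - y) \<noteq> 0 \<and> N (x - y') \<noteq> 0 \<and> N (x - y) = \<rho> * N (x - y')}"

lemma finite_K: "finite (K y y' \<rho>)"
  by (simp add: K_def finite_A)

text \<open>With \<open>z = x - y'\<close> and \<open>w = y' - y\<close> isotropic, the equation of
  the circle becomes \<open>z * cj w + cj z * w = (\<rho> - e) * N z\<close>, linear on the left and
  quadratic on the right. Scaling \<open>z\<close> by the real factor
  \<open>(\<rho> - e) / (\<sigma> - e)\<close> therefore changes the ratio from
  \<open>\<rho>\<close> to \<open>\<sigma>\<close>.\<close>

lemma card_K_isotropic_le:
  assumes y: "y \<in> A" "y' \<in> A" "N (y' - y) = 0"
    and \<rho>: "\<rho> \<in> G" "\<rho> \<noteq> e" "\<sigma> \<in> G" "\<sigma> \<noteq> e"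
  shows "card (K y y' \<rho>) \<le> card (K y y' \<sigma>)"
proof -
  define w where "w = y' - y"
  have w: "w \<in> A" "w * cj w = 0" using y by (auto simp: w_def closed N_def)
  have d: "\<rho> - e \<in> G" "\<sigma> - e \<in> G" using \<rho> by (auto simp: G_def closed cj_simps)
  define m where "m = (\<rho> - e) * iv (\<sigma> - e)"
  have m: "m \<in> G" using d iv_in_G mult_in_G by (simp add: m_def)
  have mA: "m \<in> A" "cj m = m" "N m \<noteq> 0" using m N_G by (auto simp: G_def)
  have m\<sigma>: "m * (\<sigma> - e) = \<rho> - e"
    using mult_iv[of "\<sigma> - e"] d mult_unit[of "\<rho> - e"] N_G
    by (simp add: m_def G_closed mult.assoc mult.commute[of "iv _"])
  have rel: "N (z + w) = \<tau> * N z \<longleftrightarrow> z * cj w + cj z * w = (\<tau> - e) * N z" if "z \<in> A" for z \<tau>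
  proof -
    have "N (z + w) = N z + (z * cj w + cj z * w) + w * cj w"
      using that w by (simp add: N_def cj_add algebra_simps)
    moreover have "(\<tau> - e) * N z = \<tau> * N z - N z"
      using that by (simp add: left_diff_distrib unit_mult N_closed)
    ultimately show ?thesis using w by (auto simp: algebra_simps)
  qed
  have "(\<lambda>x. m * (x - y') + y') ` K y y' \<rho> \<subseteq> K y y' \<sigma>"
  proof
    fix x' assume "x' \<in> (\<lambda>x. m * (x - y') + y') ` K y y' \<rho>"
    then obtain x where x: "x \<in> A" "N (x - y) \<noteq> 0" "N (x - y') \<noteq> 0" "N (x - y) = \<rho> * N (x - y')"
      and x': "x' = m * (x - y') + y'" by (auto simp: K_def)
    define z where "z = x - y'"
    have z: "z \<in> A" "N z \<noteq> 0" "x - y = z + w" using x y by (auto simp: z_def w_def closed)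
    have tr: "z * cj w + cj z * w = (\<rho> - e) * N z" using rel[OF z(1), of \<rho>] x(4) z(3) z_def by metis
    have "(m * z) * cj w + cj (m * z) * w = m * (z * cj w + cj z * w)"
      using mA z by (simp add: cj_mult algebra_simps)
    also have "\<dots> = m * (m * (\<sigma> - e)) * N z" unfolding tr m\<sigma> by (simp add: mult.assoc)
    also have "\<dots> = (\<sigma> - e) * N (m * z)" using mA z by (simp add: N_mult N_def[of m] mult_ac)
    finally have "N (m * z + w) = \<sigma> * N (m * z)" using rel[of "m * z" \<sigma>] mA z by (simp add: closed)
    moreover have mz: "N (m * z) \<noteq> 0" using N_mult_nonzero[of m z] mA z by simp
    moreover have "\<sigma> * N (m * z) \<noteq> 0"
      using mult_in_G[OF \<rho>(3) N_in_G[OF _ mz]] mA z by (auto simp: G_def closed)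
    moreover have "x' \<in> A" using mA x y by (simp add: x' closed)
    moreover have xy: "x' - y' = m * z" "x' - y = m * z + w" by (auto simp: x' z_def w_def)
    ultimately show "x' \<in> K y y' \<sigma>" unfolding K_def mem_Collect_eq xy by simp
  qed
  moreover have "inj_on (\<lambda>x. m * (x - y') + y') (K y y' \<rho>)"
  proof (rule inj_onI)
    fix x x' assume xx: "x \<in> K y y' \<rho>" "x' \<in> K y y' \<rho>" "m * (x - y') + y' = m * (x' - y') + y'"
    then have "m * (x - y') = m * (x' - y')" by simp
    then have "x - y' = x' - y'"
      using cancel[of m "x - y'" "x' - y'"] xx mA y by (simp add: K_def closed)
    then show "x = x'" by simp
  qed
  ultimately show ?thesis using card_inj_on_le finite_K by blast
qed

text \<open>The Moebius map \<open>x \<mapsto> (x - y) / (x - y')\<close> sends the circle into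
  \<open>S \<rho>\<close>. Its value \<open>v\<close> satisfies \<open>v - e = w / (x - y')\<close>
  with \<open>w = y' - y\<close>, which explains both the excluded points and the inverse
  map.\<close>

lemma card_K_anisotropic:
  assumes y: "y \<in> A" "y' \<in> A" "N (y' - y) \<noteq> 0" and \<rho>: "\<rho> \<in> G"
  shows "card (K y y' \<rho>) = card {v \<in> S \<rho>. N (v - e) \<noteq> 0}"
proof -
  define w where "w = y' - y"
  have w: "w \<in> A" "N w \<noteq> 0" using y by (auto simp: w_def closed)
  define i where "i = iv w"
  have i: "i \<in> A" "w * i = e" "N i \<noteq> 0" using iv[OF w] N_iv_nonzero[OF w] by (auto simp: i_def)
  have "bij_betw (\<lambda>x. (x - y) * iv (x - y')) (K y y' \<rho>) {v \<in> S \<rho>. N (v - e) \<noteq> 0}"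
  proof (rule bij_betwI[where g = "\<lambda>v. y' + w * iv (v - e)"])
    have f: "(x - y) * iv (x - y') \<in> {v \<in> S \<rho>. N (v - e) \<noteq> 0} \<and> y' + w * iv ((x - y) * iv (x - y') - e) = x"
      if x: "x \<in> K y y' \<rho>" for x
    proof -
      define z where "z = x - y'"
      have z: "z \<in> A" "N z \<noteq> 0" "x - y = z + w" "N (z + w) = \<rho> * N z" "x \<in> A"
        using x y by (auto simp: z_def w_def K_def closed)
      have j: "iv z \<in> A" "z * iv z = e" "N (iv z) \<noteq> 0"
        using iv[OF z(1,2)] N_iv_nonzero[OF z(1,2)] by auto
      have "N z * N (iv z) = e" using N_mult[of z "iv z"] z j by (simp add: N_unit)
      then have "N ((z + w) * iv z) = \<rho>"
        using z j w \<rho> by (simp add: N_mult closed mult.assoc mult_unit G_closed)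
      moreover have ve: "(z + w) * iv z - e = w * iv z" using j by (simp add: distrib_right)
      moreover have "N (w * iv z) \<noteq> 0" using N_mult_nonzero[of w "iv z"] w j by simp
      moreover have "iv (w * iv z) = z * i"
      proof (rule iv_unique)
        have "w * iv z * (z * i) = (w * i) * (z * iv z)" by (simp add: mult_ac)
        then show "w * iv z * (z * i) = e" using i j unit_mult[OF unit_closed] by simp
      qed (use w j z i in \<open>auto simp: closed\<close>)
      moreover have "w * (z * i) = z" using i z mult_unit[of z] by (metis mult.left_commute)
      ultimately show ?thesis using z j w by (simp add: S_def closed flip: z_def) (simp add: z_def)
    qed
    then show "(\<lambda>x. (x - y) * iv (x - y')) \<in> K y y' \<rho> \<rightarrow> {v \<in> S \<rho>. N (v - e) \<noteq> 0}" by blast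
    show "y' + w * iv ((x - y) * iv (x - y') - e) = x"
      if "x \<in> K y y' \<rho>" for x using f[OF that] by blast
    have g: "y' + w * iv (v - e) \<in> K y y' \<rho> \<and> (y' + w * iv (v - e) - y) * iv (y' + w * iv (v - e) - y') = v"
      if v: "v \<in> {v \<in> S \<rho>. N (v - e) \<noteq> 0}" for v
    proof -
      have vA: "v \<in> A" "N v = \<rho>" "v - e \<in> A" "N (v - e) \<noteq> 0" using v by (auto simp: S_def closed)
      define j where "j = iv (v - e)"
      have j: "j \<in> A" "(v - e) * j = e" "N j \<noteq> 0"
        using iv[OF vA(3,4)] N_iv_nonzero[OF vA(3,4)] by (auto simp: j_def)
      have jz: "w * j \<in> A" "N (w * j) \<noteq> 0" using w j N_mult_nonzero by (auto simp: closed)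
      have "e + j = v * j" using j unit_mult[of j] by (simp add: left_diff_distrib algebra_simps)
      then have xy: "w * j + w = (w * j) * v"
        using mult_unit[of w] w by (metis add.commute distrib_left mult.assoc mult.commute)
      have N1: "N (w * j + w) = \<rho> * N (w * j)"
        unfolding xy using jz(1) vA(1,2) by (metis N_mult mult.commute)
      have N2: "N (w * j + w) \<noteq> 0"
        unfolding xy using N_mult_nonzero[OF jz(1) vA(1) jz(2)] vA \<rho> by (simp add: G_def)
      have iw: "iv (w * j) = i * (v - e)"
      proof (rule iv_unique)
        have "w * j * (i * (v - e)) = (w * i) * ((v - e) * j)" by (simp add: mult_ac)
        then show "w * j * (i * (v - e)) = e" using i j unit_mult[OF unit_closed] by simp
      qed (use w j vA i in \<open>auto simp: closed\<close>)
      have "(w * j) * v * (i * (v - e)) = (w * i) * ((v - e) * j) * v" by (simp add: mult_ac)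
      then have "(w * j + w) * iv (w * j) = v"
        unfolding xy iw using i j unit_mult vA unit_closed by simp
      moreover have "y' + w * j \<in> A" using jz y by (simp add: closed)
      moreover have xy': "y' + w * j - y = w * j + w" "y' + w * j - y' = w * j"
        by (auto simp: w_def)
      ultimately show ?thesis using N1 N2 jz(2) unfolding K_def mem_Collect_eq j_def[symmetric] xy' by simp
    qed
    then show "(\<lambda>v. y' + w * iv (v - e)) \<in> {v \<in> S \<rho>. N (v - e) \<noteq> 0} \<rightarrow> K y y' \<rho>" by blast
    show "(y' + w * iv (v - e) - y) * iv (y' + w * iv (v - e) - y') = v"
      if "v \<in> {v \<in> S \<rho>. N (v - e) \<noteq> 0}" for v using g[OF that] by blast
  qed
  then show ?thesis by (rule bij_betw_same_card)
qed

lemma N_diff_unit: "v \<in> A \<Longrightarrow> N (v - e) = N v + e - (v + cj v)"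
  by (simp add: N_def cj_diff cj_unit closed unit_mult mult_unit algebra_simps)

text \<open>Such a \<open>v\<close> has norm \<open>\<rho>\<close> and trace
  \<open>s = e + \<rho>\<close>, so it is a root of v^2 - s v + \<open>\<rho>\<close>, whose
  discriminant is the square of \<open>d = e - \<rho>\<close>. Normalising, h = (2 v - s) / d
  satisfies h^2 = e and \<open>cj h = - h\<close>, conditions free of \<open>\<rho>\<close>.\<close>

lemma card_circle_isotropic_to_unit:
  assumes \<rho>: "\<rho> \<in> G" "\<rho> \<noteq> e"
  shows "card {v \<in> S \<rho>. N (v - e) = 0} = card {h \<in> A. cj h = - h \<and> h * h = e}"
proof -
  have \<rho>A: "\<rho> \<in> A" "cj \<rho> = \<rho>" using \<rho> by (auto simp: G_def)
  define d where "d = e - \<rho>"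
  define s where "s = e + \<rho>"
  define k where "k = iv d"
  define t where "t = iv (e + e)"
  have dG: "d \<in> G" using \<rho> by (auto simp: d_def G_def closed cj_simps)
  have d: "d \<in> A" "cj d = d" "k \<in> A" "cj k = k" "d * k = e"
    using dG iv_in_G[OF dG] mult_iv[of d] N_G[OF dG] by (auto simp: G_def k_def)
  have s: "s \<in> A" "cj s = s" using \<rho>A by (auto simp: s_def closed cj_simps)
  have tG: "e + e \<in> G" using two_nonzero by (auto simp: G_def closed cj_simps)
  have t: "t \<in> A" "cj t = t" "(e + e) * t = e"
    using iv_in_G[OF tG] mult_iv[of "e + e"] N_G[OF tG] tG by (auto simp: G_def t_def)
  have tt: "t * x + t * x = x" if "x \<in> A" for x
  proof -
    have "t * x + t * x = ((e + e) * t) * x"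
      using t(1) unit_mult[of "t"] by (simp add: algebra_simps flip: mult.assoc)
    then show ?thesis using t unit_mult that by simp
  qed
  have "bij_betw (\<lambda>v. (v + v - s) * k) {v \<in> S \<rho>. N (v - e) = 0} {h \<in> A. cj h = - h \<and> h * h = e}"
  proof (rule bij_betwI[where g = "\<lambda>h. t * (s + d * h)"])
    show "(\<lambda>v. (v + v - s) * k) \<in> {v \<in> S \<rho>. N (v - e) = 0} \<rightarrow> {h \<in> A. cj h = - h \<and> h * h = e}"
    proof
      fix v assume v: "v \<in> {v \<in> S \<rho>. N (v - e) = 0}"
      then have vA: "v \<in> A" "v * cj v = \<rho>" by (auto simp: S_def N_def)
      have "v + cj v = s" using N_diff_unit[of v] v by (simp add: S_def s_def algebra_simps)
      then have c: "cj v = s - v" by (simp add: algebra_simps)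
      then have "v * (s - v) = \<rho>" using vA by simp
      then have vs: "v * v = v * s - \<rho>" by (auto simp: right_diff_distrib)
      have ee: "e * e = e" "e * \<rho> = \<rho>" "\<rho> * e = \<rho>" using unit_mult mult_unit unit_closed \<rho>A by auto
      have "(v + v - s) * (v + v - s) = (v * v + v * v + v * v + v * v) - (v * s + v * s + v * s + v * s) + s * s"
        by (simp add: algebra_simps)
      also have "\<dots> = s * s - (\<rho> + \<rho> + \<rho> + \<rho>)"
        unfolding vs by (simp add: algebra_simps)
      also have "\<dots> = d * d" using ee by (simp add: s_def d_def algebra_simps)
      finally have D: "(v + v - s) * (v + v - s) = d * d" .
      have "((v + v - s) * k) * ((v + v - s) * k) = ((v + v - s) * (v + v - s)) * (k * k)"
        by (simp add: mult_ac)
      also have "\<dots> = (d * k) * (d * k)" unfolding D by (simp add: mult_ac)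
      finally have sq: "((v + v - s) * k) * ((v + v - s) * k) = e" using d ee by simp
      have "cj ((v + v - s) * k) = (cj v + cj v - s) * k"
        using vA(1) d(3,4) s by (simp add: cj_simps closed)
      also have "\<dots> = - ((v + v - s) * k)" unfolding c by (simp add: algebra_simps)
      finally have "cj ((v + v - s) * k) = - ((v + v - s) * k)" .
      then show "(v + v - s) * k \<in> {h \<in> A. cj h = - h \<and> h * h = e}"
        using sq vA d s by (simp add: closed)
    qed
    show "(\<lambda>h. t * (s + d * h)) \<in> {h \<in> A. cj h = - h \<and> h * h = e} \<rightarrow> {v \<in> S \<rho>. N (v - e) = 0}"
    proof
      fix h assume "h \<in> {h \<in> A. cj h = - h \<and> h * h = e}"
      then have h: "h \<in> A" "cj h = - h" "h * h = e" by auto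
      define v where "v = t * (s + d * h)"
      have v: "v \<in> A" using t s d h by (simp add: v_def closed)
      have c: "cj v = t * (s - d * h)" using t s d h by (simp add: v_def closed cj_simps)
      have "v + cj v = t * s + t * s" unfolding c by (simp add: v_def algebra_simps)
      then have tr: "v + cj v = s" using tt[OF s(1)] by simp
      have ee: "e * e = e" "e * \<rho> = \<rho>" "\<rho> * e = \<rho>" using unit_mult mult_unit unit_closed \<rho>A by auto
      have "v * cj v = t * t * (s * s - d * d * (h * h))"
        unfolding c by (simp add: v_def algebra_simps)
      also have "\<dots> = t * t * (s * s - d * d)" using h d mult_unit[of "d * d"] by (simp add: closed)
      also have "s * s - d * d = (\<rho> + \<rho>) + (\<rho> + \<rho>)"
        using ee by (simp add: s_def d_def algebra_simps)
      also have "t * t * ((\<rho> + \<rho>) + (\<rho> + \<rho>)) = t * (t * (\<rho> + \<rho>) + t * (\<rho> + \<rho>))"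
        by (simp add: algebra_simps)
      also have "\<dots> = t * (\<rho> + \<rho>)" using tt[of "\<rho> + \<rho>"] \<rho>A by (simp add: closed)
      also have "\<dots> = \<rho>" using tt[of \<rho>] \<rho>A by (simp add: distrib_left)
      finally have nv: "N v = \<rho>" by (simp add: N_def)
      then have "N (v - e) = 0" using N_diff_unit[OF v] tr by (simp add: s_def add.commute)
      then show "t * (s + d * h) \<in> {v \<in> S \<rho>. N (v - e) = 0}" using v nv by (simp add: S_def v_def)
    qed
    show "t * (s + d * ((v + v - s) * k)) = v" if "v \<in> {v \<in> S \<rho>. N (v - e) = 0}" for v
    proof -
      have v: "v \<in> A" using that by (simp add: S_def)
      have "d * ((v + v - s) * k) = (d * k) * (v + v - s)" by (simp add: mult_ac)
      also have "\<dots> = v + v - s" using d v s by (simp add: unit_mult closed)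
      finally have "t * (s + d * ((v + v - s) * k)) = t * v + t * v" by (simp add: distrib_left)
      then show ?thesis using tt[OF v] by simp
    qed
    show "(t * (s + d * h) + t * (s + d * h) - s) * k = h"
      if "h \<in> {h \<in> A. cj h = - h \<and> h * h = e}" for h
    proof -
      have h: "h \<in> A" using that by simp
      have "t * (s + d * h) + t * (s + d * h) - s = d * h"
        using tt[of "s + d * h"] s d h by (simp add: closed)
      moreover have "d * h * k = (d * k) * h" by (simp add: mult_ac)
      ultimately show ?thesis using d h by (simp add: unit_mult)
    qed
  qed
  then show ?thesis by (rule bij_betw_same_card)
qed

text \<open>For isotropic \<open>y' - y\<close> the circle of ratio \<open>e\<close> is empty and
  the others are scaled copies of each other. For anisotropic \<open>y' - y\<close> each circle is
  \<open>S \<rho>\<close> with some points removed, equally many for all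
  \<open>\<rho> \<noteq> e\<close>.\<close>

lemma card_K_almost_constant:
  assumes y: "y \<in> A" "y' \<in> A" "y \<noteq> y'"
  shows "\<exists>\<alpha>. (\<forall>\<rho>\<in>G - {e}. card (K y y' \<rho>) = \<alpha>) \<and> card (K y y' e) \<le> \<alpha> + 1"
proof (cases "N (y' - y) = 0")
  case True
  have "K y y' e = {}"
  proof -
    have False if "x \<in> K y y' e" for x
    proof -
      have x: "x \<in> A" "N (x - y') \<noteq> 0" "N (x - y) = N (x - y')"
        using that y by (auto simp: K_def unit_mult N_closed closed)
      then show False
        using isotropic_difference_eq_0[of "x - y'" "y' - y"] True y by (auto simp: closed)
    qed
    then show ?thesis by blast
  qed
  moreover have const: "card (K y y' \<rho>) = card (K y y' \<sigma>)" if "\<rho> \<in> G - {e}" "\<sigma> \<in> G - {e}" for \<rho> \<sigma>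
    using card_K_isotropic_le[OF y(1,2) True] that by (simp add: le_antisym)
  ultimately show ?thesis
  proof (cases "G - {e} = {}")
    case False
    then obtain \<sigma> where "\<sigma> \<in> G - {e}" by blast
    then show ?thesis using \<open>K y y' e = {}\<close>
      by (intro exI[of _ "card (K y y' \<sigma>)"] conjI ballI const) auto
  qed auto
next
  case False
  let ?J = "\<lambda>\<rho>. {v \<in> S \<rho>. N (v - e) = 0}"
  let ?h = "card {h \<in> A. cj h = - h \<and> h * h = e}"
  have c: "card (K y y' \<rho>) = \<kappa> - card (?J \<rho>)" if "\<rho> \<in> G" for \<rho>
  proof -
    have "{v \<in> S \<rho>. N (v - e) \<noteq> 0} = S \<rho> - ?J \<rho>" by auto
    moreover have "card (S \<rho> - ?J \<rho>) = card (S \<rho>) - card (?J \<rho>)"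
      by (rule card_Diff_subset) (auto simp: finite_S)
    ultimately show ?thesis using card_K_anisotropic[OF y(1,2) False that] card_S[OF that] by simp
  qed
  \<comment> \<open>For ratio \<open>e\<close> the point \<open>e\<close> itself is always removed,
    while for other ratios at most two points are; so the excess is at most one.\<close>
  have "card {e} \<le> card (?J e)"
    by (intro card_mono) (auto simp: finite_A S_def unit_closed N_unit N_zero)
  then have "\<kappa> - card (?J e) \<le> \<kappa> - ?h + 1" using card_imaginary_units by simp
  then have "card (K y y' e) \<le> \<kappa> - ?h + 1" using c[OF unit_in_G] by simp
  then show ?thesis using c card_circle_isotropic_to_unit
    by (intro exI[of _ "\<kappa> - ?h"]) auto
qed

section \<open>Autocorrelation on the multiplicative group\<close>

lemma bij_betw_mult_G:
  assumes "a \<in> G" shows "bij_betw (\<lambda>v. v * a) G G"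
proof (rule bij_betwI[where g = "\<lambda>v. v * iv a"])
  have i: "iv a \<in> G" "a * iv a = e"
    using iv_in_G[OF assms] mult_iv[of a] N_G[OF assms] assms by (auto simp: G_closed)
  show "(\<lambda>v. v * a) \<in> G \<rightarrow> G" "(\<lambda>v. v * iv a) \<in> G \<rightarrow> G"
    using assms i by (auto simp: mult_in_G)
  show "v * a * iv a = v" "v * iv a * a = v" if "v \<in> G" for v
    using i that by (simp_all add: mult.assoc mult_unit G_closed mult.commute[of "iv a"])
qed

lemma mult_iv_G: "v \<in> G \<Longrightarrow> a \<in> G \<Longrightarrow> v * a * iv a = v"
  using mult_iv[of a] N_G[of a] by (simp add: mult.assoc mult_unit G_closed)

lemma sum_G_shift: "a \<in> G \<Longrightarrow> (\<Sum>s\<in>G. g (s * a)) = (\<Sum>s\<in>G. (g s :: real))"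
  using sum.reindex_bij_betw[OF bij_betw_mult_G, of a g] by simp

definition corr :: "('a \<Rightarrow> real) \<Rightarrow> 'a \<Rightarrow> real" where "corr f \<rho> = (\<Sum>v\<in>G. f v * f (v * \<rho>))"

lemma sum_shifted_product:
  assumes "a \<in> G" "b \<in> G"
  shows "(\<Sum>s\<in>G. f (s * iv a) * f (s * iv b)) = corr f (a * iv b)"
proof -
  have "(\<Sum>s\<in>G. f (s * iv a) * f (s * iv b)) = (\<Sum>v\<in>G. f (v * a * iv a) * f (v * a * iv b))"
    using sum_G_shift[OF assms(1), of "\<lambda>s. f (s * iv a) * f (s * iv b)"] by simp
  also have "\<dots> = (\<Sum>v\<in>G. f v * f (v * (a * iv b)))"
    using assms(1) by (intro sum.cong refl) (metis mult.assoc mult_iv_G)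
  finally show ?thesis by (simp add: corr_def)
qed

lemma sum_corr: "(\<Sum>\<rho>\<in>G. corr f \<rho>) = (\<Sum>v\<in>G. f v)\<^sup>2"
proof -
  have "(\<Sum>\<rho>\<in>G. corr f \<rho>) = (\<Sum>v\<in>G. f v * (\<Sum>\<rho>\<in>G. f (\<rho> * v)))"
    unfolding corr_def by (subst sum.swap) (simp add: sum_distrib_left mult.commute)
  also have "\<dots> = (\<Sum>v\<in>G. f v * (\<Sum>\<rho>\<in>G. f \<rho>))"
    by (intro sum.cong refl) (simp add: sum_G_shift)
  finally show ?thesis by (simp add: power2_eq_square sum_distrib_right)
qed

lemma corr_unit: "corr f e = (\<Sum>v\<in>G. (f v)\<^sup>2)"
  unfolding corr_def power2_eq_square by (intro sum.cong refl) (simp add: mult_unit G_closed)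

text \<open>Grouping \<open>x\<close> by the ratio weights \<open>corr f \<rho>\<close> with
  \<open>card (K y y' \<rho>)\<close>. The constant part of the weight contributes nothing, because
  the correlations sum to the square of the sum of \<open>f\<close>; what remains is the excess of
  at most one at \<open>e\<close>.\<close>

lemma sum_corr_ratio_le:
  assumes y: "y \<in> A" "y' \<in> A" "y \<noteq> y'" and f: "(\<Sum>v\<in>G. f v) = 0"
  shows "(\<Sum>x\<in>{x \<in> A. N (x - y) \<noteq> 0 \<and> N (x - y') \<noteq> 0}. corr f (N (x - y) * iv (N (x - y')))) \<le> corr f e"
proof -
  let ?X = "{x \<in> A. N (x - y) \<noteq> 0 \<and> N (x - y') \<noteq> 0}"
  let ?g = "\<lambda>x. N (x - y) * iv (N (x - y'))"
  obtain \<alpha> where \<alpha>: "\<And>\<rho>. \<rho> \<in> G \<Longrightarrow> \<rho> \<noteq> e \<Longrightarrow> card (K y y' \<rho>) = \<alpha>" "card (K y y' e) \<le> \<alpha> + 1"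
    using card_K_almost_constant[OF y] by blast
  have gG: "N (x - y) \<in> G" "N (x - y') \<in> G" if "x \<in> ?X" for x
    using that y by (auto intro!: N_in_G closed)
  have K: "{x \<in> ?X. ?g x = \<rho>} = K y y' \<rho>" if "\<rho> \<in> G" for \<rho>
  proof -
    have "?g x = \<rho> \<longleftrightarrow> N (x - y) = \<rho> * N (x - y')" if x: "x \<in> ?X" for x
    proof
      have i: "iv (N (x - y')) * N (x - y') = e"
        using mult_iv[of "N (x - y')"] gG[OF x] N_G by (simp add: mult.commute G_closed)
      assume g: "?g x = \<rho>"
      have "\<rho> * N (x - y') = N (x - y) * (iv (N (x - y')) * N (x - y'))"
        unfolding g[symmetric] by (rule mult.assoc)
      then show "N (x - y) = \<rho> * N (x - y')" using i gG[OF x] by (simp add: mult_unit G_closed)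
    next
      assume "N (x - y) = \<rho> * N (x - y')"
      then show "?g x = \<rho>" using mult_iv_G[OF \<open>\<rho> \<in> G\<close> gG(2)[OF x]] by simp
    qed
    then show ?thesis by (auto simp: K_def)
  qed
  have "(\<Sum>x\<in>?X. corr f (?g x)) = (\<Sum>\<rho>\<in>G. \<Sum>x\<in>{x \<in> ?X. ?g x = \<rho>}. corr f (?g x))"
    using gG by (intro sum.group[symmetric]) (auto simp: finite_A finite_G intro!: mult_in_G iv_in_G)
  also have "\<dots> = (\<Sum>\<rho>\<in>G. real (card (K y y' \<rho>)) * corr f \<rho>)"
  proof (rule sum.cong[OF refl])
    fix \<rho> assume "\<rho> \<in> G"
    have "(\<Sum>x\<in>{x \<in> ?X. ?g x = \<rho>}. corr f (?g x)) = (\<Sum>x\<in>{x \<in> ?X. ?g x = \<rho>}. corr f \<rho>)"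
      by (rule sum.cong) auto
    then show "(\<Sum>x\<in>{x \<in> ?X. ?g x = \<rho>}. corr f (?g x)) = real (card (K y y' \<rho>)) * corr f \<rho>"
      unfolding K[OF \<open>\<rho> \<in> G\<close>] by simp
  qed
  also have "\<dots> = (\<Sum>\<rho>\<in>G. real \<alpha> * corr f \<rho> + (if \<rho> = e then (real (card (K y y' e)) - real \<alpha>) * corr f e else 0))"
    using \<alpha>(1) by (intro sum.cong refl) (auto simp: algebra_simps)
  also have "\<dots> = real \<alpha> * (\<Sum>\<rho>\<in>G. corr f \<rho>) + (real (card (K y y' e)) - real \<alpha>) * corr f e"
    by (simp add: sum.distrib sum_distrib_left finite_G unit_in_G)
  also have "\<dots> = (real (card (K y y' e)) - real \<alpha>) * corr f e"
    by (simp add: sum_corr f)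
  also have "\<dots> \<le> 1 * corr f e"
    using \<alpha>(2) by (intro mult_right_mono) (auto simp: corr_unit sum_nonneg)
  finally show ?thesis by simp
qed

end

context plane_set
begin

text \<open>Cauchy-Schwarz in \<open>x\<close>, after which \<open>x\<close> may range over the
  whole plane, and expansion of the square in \<open>y\<close>. Each of the n diagonal pairs costs
  at most q^2 times the square norm of \<open>f\<close>, each other pair at most this norm once, by
  \<open>sum_corr_ratio_le\<close>; finally n is at most q^2.\<close>

lemma sum_multiplicative_convolution_square_le:
  assumes f: "(\<Sum>v\<in>G. f v) = (0 :: real)"
  shows "(\<Sum>s\<in>G. (\<Sum>x\<in>E. \<Sum>y\<in>E. of_bool (N (x - y) \<noteq> 0) * f (s * iv (N (x - y))))\<^sup>2)
    \<le> 2 * (real (card E))\<^sup>2 * (real q)\<^sup>2 * (\<Sum>v\<in>G. (f v)\<^sup>2)"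
proof -
  let ?n = "real (card E)"
  define k where "k s x y = of_bool (N (x - y) \<noteq> 0) * f (s * iv (N (x - y)))" for s x y
  let ?F = "\<Sum>v\<in>G. (f v)\<^sup>2"
  have F0: "?F \<ge> 0" by (simp add: sum_nonneg)
  have pair: "(\<Sum>s\<in>G. \<Sum>x\<in>A. k s x y * k s x y') \<le> (if y = y' then (real q)\<^sup>2 * ?F else 0) + ?F"
    if y: "y \<in> E" "y' \<in> E" for y y'
  proof -
    let ?X = "{x \<in> A. N (x - y) \<noteq> 0 \<and> N (x - y') \<noteq> 0}"
    have yA: "y \<in> A" "y' \<in> A" using y E_in_A by auto
    have gG: "N (x - y) \<in> G" "N (x - y') \<in> G" if "x \<in> ?X" for x
      using that yA by (auto intro!: N_in_G closed)
    have "(\<Sum>s\<in>G. \<Sum>x\<in>A. k s x y * k s x y') = (\<Sum>x\<in>A. \<Sum>s\<in>G. k s x y * k s x y')"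
      by (rule sum.swap)
    also have "\<dots> = (\<Sum>x\<in>?X. \<Sum>s\<in>G. k s x y * k s x y')"
      by (rule sum.mono_neutral_right) (auto simp: finite_A k_def)
    also have "\<dots> = (\<Sum>x\<in>?X. corr f (N (x - y) * iv (N (x - y'))))"
    proof (rule sum.cong[OF refl])
      fix x assume x: "x \<in> ?X"
      then show "(\<Sum>s\<in>G. k s x y * k s x y') = corr f (N (x - y) * iv (N (x - y')))"
        using sum_shifted_product[OF gG[OF x], of f] by (simp add: k_def)
    qed
    also have "\<dots> \<le> (if y = y' then (real q)\<^sup>2 * ?F else 0) + ?F"
    proof (cases "y = y'")
      case True
      have "(\<Sum>x\<in>?X. corr f (N (x - y) * iv (N (x - y')))) = (\<Sum>x\<in>?X. ?F)"
      proof (rule sum.cong[OF refl])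
        fix x assume x: "x \<in> ?X"
        have "N (x - y) * iv (N (x - y')) = e"
          using True mult_iv[of "N (x - y)"] gG[OF x] N_G by (simp add: G_closed)
        then show "corr f (N (x - y) * iv (N (x - y'))) = ?F" by (simp add: corr_unit)
      qed
      also have "\<dots> = real (card ?X) * ?F" by simp
      also have "\<dots> \<le> (real q)\<^sup>2 * ?F"
        using card_mono[OF finite_A, of ?X] F0
        by (intro mult_right_mono) (auto simp: card_A simp flip: of_nat_power)
      finally show ?thesis using True F0 by simp
    next
      case False
      then show ?thesis using sum_corr_ratio_le[OF yA False f] by (simp add: corr_unit)
    qed
    finally show ?thesis .
  qed
  have "(\<Sum>s\<in>G. (\<Sum>x\<in>E. \<Sum>y\<in>E. k s x y)\<^sup>2) \<le> (\<Sum>s\<in>G. ?n * (\<Sum>x\<in>A. (\<Sum>y\<in>E. k s x y)\<^sup>2))"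
  proof (rule sum_mono)
    fix s
    have "(\<Sum>x\<in>E. \<Sum>y\<in>E. k s x y)\<^sup>2 \<le> ?n * (\<Sum>x\<in>E. (\<Sum>y\<in>E. k s x y)\<^sup>2)"
      by (rule sum_square_le_card_sum_square)
    also have "\<dots> \<le> ?n * (\<Sum>x\<in>A. (\<Sum>y\<in>E. k s x y)\<^sup>2)"
      using E_subset by (intro mult_left_mono sum_mono2 finite_A) auto
    finally show "(\<Sum>x\<in>E. \<Sum>y\<in>E. k s x y)\<^sup>2 \<le> ?n * (\<Sum>x\<in>A. (\<Sum>y\<in>E. k s x y)\<^sup>2)" .
  qed
  also have "\<dots> = ?n * (\<Sum>s\<in>G. \<Sum>x\<in>A. \<Sum>y\<in>E. \<Sum>y'\<in>E. k s x y * k s x y')"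
    by (simp only: power2_eq_square sum_product sum_distrib_left[where r = "real (card E)", symmetric])
  also have "\<dots> = ?n * (\<Sum>y\<in>E. \<Sum>y'\<in>E. \<Sum>s\<in>G. \<Sum>x\<in>A. k s x y * k s x y')"
    by (rule arg_cong[OF sum_swap_pairs])
  also have "\<dots> \<le> ?n * (\<Sum>y\<in>E. \<Sum>y'\<in>E. (if y = y' then (real q)\<^sup>2 * ?F else 0) + ?F)"
    using pair by (intro mult_left_mono sum_mono) auto
  also have "\<dots> = ?n\<^sup>2 * ((real q)\<^sup>2 + ?n) * ?F"
    using finite_E by (simp add: sum.distrib algebra_simps power2_eq_square)
  also have "\<dots> \<le> ?n\<^sup>2 * (2 * (real q)\<^sup>2) * ?F"
    using card_E_le F0 by (intro mult_right_mono mult_left_mono) auto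
  finally show ?thesis by (simp add: k_def mult_ac)
qed

section \<open>Multiplicative energy of the distance counts\<close>

definition \<Delta> :: "'a set" where "\<Delta> = {N (x - y) | x y. x \<in> E \<and> y \<in> E}"

definition W :: real where "W = (\<Sum>r\<in>G. real (\<nu> r))"

lemma W_eq: "W = (\<Sum>x\<in>E. \<Sum>y\<in>E. of_bool (N (x - y) \<noteq> 0))"
proof -
  have "real (\<nu> r) = (\<Sum>p\<in>E \<times> E. of_bool (N (fst p - snd p) = r))" for r
  proof -
    have "{(x, y). x \<in> E \<and> y \<in> E \<and> N (x - y) = r} = {p \<in> E \<times> E. N (fst p - snd p) = r}" by auto
    then show ?thesis using finite_E by (simp add: \<nu>_def card_filter_eq_sum)
  qed
  then have "W = (\<Sum>r\<in>G. \<Sum>p\<in>E \<times> E. of_bool (N (fst p - snd p) = r))" by (simp add: W_def)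
  also have "\<dots> = (\<Sum>p\<in>E \<times> E. \<Sum>r\<in>G. of_bool (N (fst p - snd p) = r))" by (rule sum.swap)
  also have "\<dots> = (\<Sum>p\<in>E \<times> E. of_bool (N (fst p - snd p) \<noteq> 0))"
  proof (rule sum.cong[OF refl])
    fix p assume "p \<in> E \<times> E"
    then have "N (fst p - snd p) \<noteq> 0 \<longleftrightarrow> N (fst p - snd p) \<in> G"
      using N_in_G[of "fst p - snd p"] E_in_A by (auto simp: closed G_def)
    then show "(\<Sum>r\<in>G. of_bool (N (fst p - snd p) = r)) = (of_bool (N (fst p - snd p) \<noteq> 0) :: real)"
      by (simp add: of_bool_def finite_G)
  qed
  finally show ?thesis by (simp add: sum.cartesian_product case_prod_beta)
qed

text \<open>For each \<open>x\<close> fewer than \<open>2 * q\<close> points of \<open>E\<close>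
  differ from it by an isotropic vector.\<close>

lemma W_ge: "W \<ge> (real (card E))\<^sup>2 - 2 * real q * real (card E)"
proof -
  let ?n = "real (card E)"
  have "?n - 2 * real q \<le> (\<Sum>y\<in>E. of_bool (N (x - y) \<noteq> 0))" if x: "x \<in> E" for x
  proof -
    have "card {y \<in> E. N (x - y) = 0} \<le> card {z \<in> A. N z = 0}"
      by (rule card_inj_on_le[where f = "\<lambda>y. x - y"])
        (use x in \<open>auto simp: inj_on_def E_in_A closed finite_A\<close>)
    also have "\<dots> \<le> 2 * q - 1" using card_isotropic by (simp add: N_def)
    finally have "real (card {y \<in> E. N (x - y) = 0}) \<le> 2 * real q" by linarith
    moreover have "(\<Sum>y\<in>E. of_bool (N (x - y) \<noteq> 0) + of_bool (N (x - y) = 0)) = (\<Sum>y\<in>E. 1 :: real)"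
      by (intro sum.cong) auto
    ultimately show ?thesis using finite_E by (simp add: sum.distrib card_filter_eq_sum)
  qed
  then have "(\<Sum>x\<in>E. ?n - 2 * real q) \<le> W" unfolding W_eq by (rule sum_mono)
  then show ?thesis by (simp add: algebra_simps power2_eq_square)
qed

lemma W_le: "W \<le> (real (card E))\<^sup>2" and W_nonneg: "W \<ge> 0"
proof -
  have "W \<le> (\<Sum>x\<in>E. \<Sum>y\<in>E. 1)" unfolding W_eq by (intro sum_mono) simp
  then show "W \<le> (real (card E))\<^sup>2" by (simp add: power2_eq_square)
  show "W \<ge> 0" by (simp add: W_def sum_nonneg)
qed

text \<open>On \<open>G\<close> this is the multiplicative convolution of \<open>\<nu>\<close> with
  itself. One factor is unfolded into pairs of points to match the convolution estimate
  above.\<close>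

definition prod_count :: "'a \<Rightarrow> real"
  where "prod_count s = (\<Sum>x\<in>E. \<Sum>y\<in>E. of_bool (N (x - y) \<noteq> 0) * real (\<nu> (s * iv (N (x - y)))))"

lemma sum_prod_count: "(\<Sum>s\<in>G. prod_count s) = W\<^sup>2"
proof -
  have "(\<Sum>s\<in>G. prod_count s)
      = (\<Sum>x\<in>E. \<Sum>y\<in>E. \<Sum>s\<in>G. of_bool (N (x - y) \<noteq> 0) * real (\<nu> (s * iv (N (x - y)))))"
    unfolding prod_count_def by (subst sum.swap) (intro sum.cong refl sum.swap)
  also have "\<dots> = (\<Sum>x\<in>E. \<Sum>y\<in>E. of_bool (N (x - y) \<noteq> 0) * W)"
  proof (intro sum.cong refl)
    fix x y assume "x \<in> E" "y \<in> E"
    then have "N (x - y) \<noteq> 0 \<Longrightarrow> iv (N (x - y)) \<in> G"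
      using E_in_A by (intro iv_in_G N_in_G) (auto simp: closed)
    then show "(\<Sum>s\<in>G. of_bool (N (x - y) \<noteq> 0) * real (\<nu> (s * iv (N (x - y))))) = of_bool (N (x - y) \<noteq> 0) * W"
      using sum_G_shift[of "iv (N (x - y))" "\<lambda>s. real (\<nu> s)"] by (simp add: W_def)
  qed
  also have "\<dots> = W\<^sup>2"
    unfolding power2_eq_square by (subst (2) W_eq) (simp add: sum_distrib_right)
  finally show ?thesis .
qed

text \<open>Replacing \<open>\<nu>\<close> by its deviation \<open>f\<close> from the mean
  \<open>m\<close> subtracts \<open>W * m\<close> from \<open>prod_count\<close>, which is exactly
  the mean of \<open>prod_count\<close>. The convolution bound for \<open>f\<close> is thus a
  variance bound.\<close>

lemma sum_prod_count_square_le: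
  "(\<Sum>s\<in>G. (prod_count s)\<^sup>2)
    \<le> W ^ 4 / real (q - 1) + 2 * (real (card E))\<^sup>2 * (real q)\<^sup>2 * (\<Sum>r\<in>G. (real (\<nu> r))\<^sup>2)"
proof -
  define c where "c = real (q - 1)"
  define m where "m = W / c"
  define f where "f r = real (\<nu> r) - m" for r
  have c: "c > 0" using q_ge by (simp add: c_def)
  have cG: "real (card G) = c" by (simp add: card_G c_def)
  have f0: "(\<Sum>v\<in>G. f v) = 0" using c by (simp add: f_def sum_subtractf cG m_def W_def)
  have "(\<Sum>x\<in>E. \<Sum>y\<in>E. of_bool (N (x - y) \<noteq> 0) * f (s * iv (N (x - y)))) = prod_count s - W * m" for s
  proof -
    have "W * m = (\<Sum>x\<in>E. \<Sum>y\<in>E. of_bool (N (x - y) \<noteq> 0) * m)"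
      by (subst W_eq) (simp add: sum_distrib_right)
    then show ?thesis by (simp add: prod_count_def f_def right_diff_distrib sum_subtractf)
  qed
  then have "(\<Sum>s\<in>G. (prod_count s - W * m)\<^sup>2)
      \<le> 2 * (real (card E))\<^sup>2 * (real q)\<^sup>2 * (\<Sum>v\<in>G. (f v)\<^sup>2)"
    using sum_multiplicative_convolution_square_le[OF f0] by simp
  also have "(\<Sum>v\<in>G. (f v)\<^sup>2) = (\<Sum>r\<in>G. (real (\<nu> r))\<^sup>2) - 2 * m * W + c * m\<^sup>2"
    unfolding f_def sum_centered_square W_def cG ..
  also have "\<dots> = (\<Sum>r\<in>G. (real (\<nu> r))\<^sup>2) - W\<^sup>2 / c"
    using c by (simp add: m_def field_simps power2_eq_square)
  also have "\<dots> \<le> (\<Sum>r\<in>G. (real (\<nu> r))\<^sup>2)" using c by simp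
  finally have "(\<Sum>s\<in>G. (prod_count s - W * m)\<^sup>2)
      \<le> 2 * (real (card E))\<^sup>2 * (real q)\<^sup>2 * (\<Sum>r\<in>G. (real (\<nu> r))\<^sup>2)"
    by (simp add: mult_left_mono)
  moreover have "(\<Sum>s\<in>G. (prod_count s - W * m)\<^sup>2) = (\<Sum>s\<in>G. (prod_count s)\<^sup>2) - W ^ 4 / c"
    unfolding sum_centered_square sum_prod_count cG
    using c by (simp add: m_def field_simps power2_eq_square power4_eq_xxxx)
  ultimately show ?thesis by (simp add: c_def)
qed

text \<open>The support of \<open>prod_count\<close> on \<open>G\<close> consists of products of two
  distances, and W^2 is its total mass. Cauchy-Schwarz on the support gives the inequality.\<close>

lemma W_power4_le:
  "W ^ 4 \<le> real (card {a * b | a b. a \<in> \<Delta> \<and> b \<in> \<Delta>}) * (\<Sum>s\<in>G. (prod_count s)\<^sup>2)"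
proof -
  let ?D = "{a * b | a b. a \<in> \<Delta> \<and> b \<in> \<Delta>}"
  define Y where "Y = {s \<in> G. prod_count s \<noteq> 0}"
  have "Y \<subseteq> ?D"
  proof
    fix s assume "s \<in> Y"
    then have s: "s \<in> G" "prod_count s \<noteq> 0" by (auto simp: Y_def)
    then obtain x where "x \<in> E" "(\<Sum>y\<in>E. of_bool (N (x - y) \<noteq> 0) * real (\<nu> (s * iv (N (x - y))))) \<noteq> 0"
      unfolding prod_count_def by (meson sum.neutral)
    then obtain y where xy: "x \<in> E" "y \<in> E" "of_bool (N (x - y) \<noteq> 0) * real (\<nu> (s * iv (N (x - y)))) \<noteq> 0"
      by (meson sum.neutral)
    then have nz: "N (x - y) \<noteq> 0" "\<nu> (s * iv (N (x - y))) \<noteq> 0" by auto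
    have g: "N (x - y) \<in> G" using nz xy E_in_A by (intro N_in_G) (auto simp: closed)
    from nz(2) have "{(x', y'). x' \<in> E \<and> y' \<in> E \<and> N (x' - y') = s * iv (N (x - y))} \<noteq> {}"
      unfolding \<nu>_def using card.empty by metis
    then obtain x' y' where xy': "x' \<in> E" "y' \<in> E" "N (x' - y') = s * iv (N (x - y))" by auto
    have "s * iv (N (x - y)) * N (x - y) = s"
      using mult_iv_G[OF s(1) g] by (simp add: mult_ac)
    then have "s = N (x' - y') * N (x - y)" using xy' by simp
    moreover have "N (x' - y') \<in> \<Delta>" "N (x - y) \<in> \<Delta>"
      using xy(1,2) xy'(1,2) unfolding \<Delta>_def by blast+
    ultimately show "s \<in> ?D" by blast
  qed
  moreover have "finite ?D"
  proof -
    have "?D \<subseteq> A" by (auto simp: \<Delta>_def E_in_A closed N_closed)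
    then show ?thesis using finite_A finite_subset by blast
  qed
  ultimately have "real (card Y) \<le> real (card ?D)" by (simp add: card_mono)
  have "(\<Sum>s\<in>G. prod_count s) = (\<Sum>s\<in>Y. prod_count s)"
    by (rule sum.mono_neutral_right) (auto simp: finite_G Y_def)
  then have "W\<^sup>2 = (\<Sum>s\<in>Y. prod_count s)" using sum_prod_count by simp
  moreover have "W ^ 4 = (W\<^sup>2)\<^sup>2" by (simp flip: power_mult)
  ultimately have "W ^ 4 = (\<Sum>s\<in>Y. prod_count s)\<^sup>2" by simp
  also have "\<dots> \<le> real (card Y) * (\<Sum>s\<in>Y. (prod_count s)\<^sup>2)"
    by (rule sum_square_le_card_sum_square)
  also have "\<dots> \<le> real (card ?D) * (\<Sum>s\<in>G. (prod_count s)\<^sup>2)"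
    using \<open>real (card Y) \<le> real (card ?D)\<close>
    by (intro mult_mono sum_mono2 finite_G) (auto simp: Y_def sum_nonneg)
  finally show ?thesis .
qed

theorem card_product_distance_set_ge:
  assumes n: "real (card E) \<ge> 4 * real q powr (8 / 7)"
  shows "real (card {a * b | a b. a \<in> \<Delta> \<and> b \<in> \<Delta>}) \<ge> 1 / 416 * real q"
proof -
  let ?n = "real (card E)" and ?q = "real q"
  let ?D = "real (card {a * b | a b. a \<in> \<Delta> \<and> b \<in> \<Delta>})" and ?P = "\<Sum>r\<in>G. (real (\<nu> r))\<^sup>2"
  have q: "?q \<ge> 3" using q_ge by simp
  have "?q powr 1 \<le> ?q powr (8 / 7)" using q by (intro powr_mono) auto
  then have nq: "?n \<ge> 4 * ?q" using n q by simp
  then have n0: "?n > 0" using q by linarith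
  \<comment> \<open>This is where the exponent comes from: the energy term q^3 * n^(9/2) is at most
    n^8 / q exactly when q^4 is at most n^(7/2).\<close>
  have "?q ^ 4 = (?q powr (8 / 7)) powr (7 / 2)" using q by (simp add: powr_powr flip: powr_numeral)
  also have "\<dots> \<le> ?n powr (7 / 2)" using n by (intro powr_mono2) auto
  also have "?n powr (7 / 2) = ?n powr (3 + 1 / 2)" by simp
  also have "\<dots> = ?n ^ 3 * sqrt ?n" unfolding powr_add using n0 by (simp add: powr_half_sqrt)
  finally have q4: "?q ^ 4 \<le> ?n ^ 3 * sqrt ?n" .
  have P: "?P \<le> 4 * ?n ^ 4 / ?q + 8 * ?q * ?n\<^sup>2 * sqrt ?n" by (rule sum_\<nu>_square_le[OF nq])
  have W4: "W ^ 4 \<le> ?n ^ 8" using power_mono[OF W_le W_nonneg, of 4] by (simp flip: power_mult)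
  have "1 / real (q - 1) \<le> 2 / ?q" using q_ge by (simp add: field_simps of_nat_diff)
  then have "W ^ 4 * (1 / real (q - 1)) \<le> ?n ^ 8 * (2 / ?q)" using W4 by (intro mult_mono) auto
  then have 1: "W ^ 4 / real (q - 1) \<le> 2 * (?n ^ 8 / ?q)" by (simp add: mult.commute)
  have "2 * ?n\<^sup>2 * ?q\<^sup>2 * ?P \<le> 2 * ?n\<^sup>2 * ?q\<^sup>2 * (4 * ?n ^ 4 / ?q + 8 * ?q * ?n\<^sup>2 * sqrt ?n)"
    using P by (intro mult_left_mono) auto
  also have "\<dots> = 8 * (?n ^ 6 * ?q\<^sup>2 / ?q) + 16 * (?n ^ 4 * sqrt ?n * ?q ^ 4 / ?q)"
    using q by (simp add: field_simps eval_nat_numeral)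
  also have "?n ^ 6 * ?q\<^sup>2 / ?q \<le> ?n ^ 6 * ?n\<^sup>2 / ?q"
    using nq q by (intro divide_right_mono mult_left_mono power_mono) auto
  also have "?n ^ 4 * sqrt ?n * ?q ^ 4 / ?q \<le> ?n ^ 4 * sqrt ?n * (?n ^ 3 * sqrt ?n) / ?q"
    using q4 q by (intro divide_right_mono mult_left_mono) auto
  also have "?n ^ 6 * ?n\<^sup>2 = ?n ^ 8" by (simp flip: power_add)
  also have "?n ^ 4 * sqrt ?n * (?n ^ 3 * sqrt ?n) = ?n ^ 7 * (sqrt ?n * sqrt ?n)"
    by (simp add: eval_nat_numeral)
  also have "\<dots> = ?n ^ 8" by (simp add: eval_nat_numeral)
  finally have 2: "2 * ?n\<^sup>2 * ?q\<^sup>2 * ?P \<le> 24 * (?n ^ 8 / ?q)" by simp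
  \<comment> \<open>The constant 26 is 2 from the mean term plus 8 and 16 from the variance
    term.\<close>
  have S: "(\<Sum>s\<in>G. (prod_count s)\<^sup>2) \<le> 26 * (?n ^ 8 / ?q)"
    using order_trans[OF sum_prod_count_square_le add_mono[OF 1 2]] by simp
  \<comment> \<open>At least half of all pairs have nonzero distance, so W^4 is at least n^8 / 16,
    and 16 * 26 = 416.\<close>
  have "2 * ?q * ?n \<le> ?n / 2 * ?n" using nq n0 by (intro mult_right_mono) auto
  then have "W \<ge> ?n\<^sup>2 / 2" using W_ge by (simp add: power2_eq_square)
  then have "(?n\<^sup>2 / 2) ^ 4 \<le> W ^ 4" by (intro power_mono) auto
  also have "\<dots> \<le> ?D * (\<Sum>s\<in>G. (prod_count s)\<^sup>2)" by (rule W_power4_le)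
  also have "\<dots> \<le> ?D * (26 * (?n ^ 8 / ?q))" using S by (intro mult_left_mono) auto
  finally have "?n ^ 8 / 16 \<le> ?D * (26 * (?n ^ 8 / ?q))"
    by (simp add: power_divide flip: power_mult)
  then have "?n ^ 8 * ?q \<le> ?n ^ 8 * (416 * ?D)" using q by (simp add: field_simps)
  then show ?thesis using n0 by simp
qed

end

section \<open>The Gaussian extension of a finite field\<close>

text \<open>\<open>Gauss a b\<close> stands for a + b i with i^2 = -1.\<close>

datatype 'a gauss = Gauss 'a 'a

instantiation gauss :: (comm_ring) comm_ring
begin

definition zero_gauss where "0 = Gauss 0 0"
fun plus_gauss where "Gauss a b + Gauss c d = Gauss (a + c) (b + d)"
fun minus_gauss where "Gauss a b - Gauss c d = Gauss (a - c) (b - d)"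
fun uminus_gauss where "- Gauss a b = Gauss (- a) (- b)"
fun times_gauss where "Gauss a b * Gauss c d = Gauss (a * c - b * d) (a * d + b * c)"

instance
proof
  fix x y z :: "'a gauss"
  show "x * y * z = x * (y * z)" by (cases x; cases y; cases z) (simp add: algebra_simps)
  show "x * y = y * x" by (cases x; cases y) (simp add: algebra_simps)
  show "x + y + z = x + (y + z)" by (cases x; cases y; cases z) (simp add: algebra_simps)
  show "x + y = y + x" by (cases x; cases y) (simp add: algebra_simps)
  show "0 + x = x" by (cases x) (simp add: zero_gauss_def)
  show "- x + x = 0" by (cases x) (simp add: zero_gauss_def)
  show "x - y = x + - y" by (cases x; cases y) simp
  show "(x + y) * z = x * z + y * z" by (cases x; cases y; cases z) (simp add: algebra_simps)
qed

end

text \<open>A field lying inside a commutative ring with its own unit \<open>e\<close>. Odd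
  cardinality stands for characteristic other than two.\<close>

locale finite_subfield =
  fixes K :: "'a::comm_ring set" and e :: 'a
  assumes finite_K: "finite K" and odd_card: "odd (card K)"
    and zero_closed: "0 \<in> K" and unit_closed: "e \<in> K"
    and add_closed: "x \<in> K \<Longrightarrow> y \<in> K \<Longrightarrow> x + y \<in> K"
    and uminus_closed: "x \<in> K \<Longrightarrow> - x \<in> K"
    and mult_closed: "x \<in> K \<Longrightarrow> y \<in> K \<Longrightarrow> x * y \<in> K"
    and unit_mult: "x \<in> K \<Longrightarrow> e * x = x"
    and unit_nonzero: "e \<noteq> 0"
    and inverse: "x \<in> K \<Longrightarrow> x \<noteq> 0 \<Longrightarrow> \<exists>y\<in>K. x * y = e"
begin

section \<open>Squares in a finite field of odd order\<close>

lemma diff_closed: "x \<in> K \<Longrightarrow> y \<in> K \<Longrightarrow> x - y \<in> K"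
  using add_closed[of x "- y"] uminus_closed by simp

lemmas closed = zero_closed unit_closed add_closed uminus_closed mult_closed diff_closed

lemma mult_unit: "x \<in> K \<Longrightarrow> x * e = x"
  by (metis mult.commute unit_mult)

lemma no_zero_divisors:
  assumes "x \<in> K" "y \<in> K" "x * y = 0" shows "x = 0 \<or> y = 0"
proof (rule ccontr)
  assume "\<not> ?thesis"
  then obtain z where "z \<in> K" "x * z = e" "y \<noteq> 0" using inverse assms(1) by auto
  moreover have "(x * z) * y = z * (x * y)" by (simp only: mult_ac)
  ultimately show False using assms by (simp add: unit_mult)
qed

lemma sum_const_unit:
  assumes "e + e = 0" "finite T" shows "(\<Sum>x\<in>T. e) = (if even (card T) then 0 else e)"
  using assms(2) by (induction T rule: finite_induct) (auto simp: assms(1))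

text \<open>Translation by \<open>e\<close> permutes \<open>K\<close>, so adding up
  \<open>card K\<close> copies of \<open>e\<close> gives 0; if \<open>e + e = 0\<close>, an odd
  number of copies would give \<open>e\<close>.\<close>

lemma two_nonzero: "e + e \<noteq> 0"
proof
  assume 2: "e + e = 0"
  have "bij_betw (\<lambda>x. x + e) K K"
    by (rule bij_betwI[where g = "\<lambda>x. x - e"]) (auto simp: closed)
  then have "(\<Sum>x\<in>K. x + e) = (\<Sum>x\<in>K. x)" by (rule sum.reindex_bij_betw)
  then have "(\<Sum>x\<in>K. e) = 0" by (simp add: sum.distrib)
  then show False using sum_const_unit[OF 2 finite_K] odd_card unit_nonzero by simp
qed

lemma double_eq_0: "x \<in> K \<Longrightarrow> x + x = 0 \<Longrightarrow> x = 0"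
  using no_zero_divisors[of "e + e" x] two_nonzero by (simp add: closed distrib_right unit_mult)

lemma card_ge: "card K \<ge> 3"
proof -
  have "card {0, e} \<le> card K" using finite_K closed by (intro card_mono) auto
  then show ?thesis using odd_card unit_nonzero by (cases "card K = 2") auto
qed

lemma square_eq: 
  assumes "x \<in> K" "y \<in> K" "x * x = y * y" shows "x = y \<or> x = - y"
proof -
  have "(x - y) * (x + y) = 0" using assms by (simp add: algebra_simps)
  then show ?thesis using no_zero_divisors[of "x - y" "x + y"] assms
    by (auto simp: closed eq_neg_iff_add_eq_0)
qed

lemma card_square_roots: "card {x \<in> K. x * x = c} \<le> 2"
proof (cases "{x \<in> K. x * x = c} = {}")
  case False
  then obtain y where "y \<in> K" "y * y = c" by auto
  then have "{x \<in> K. x * x = c} \<subseteq> {y, - y}" using square_eq[of _ y] by auto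
  then have "card {x \<in> K. x * x = c} \<le> card {y, - y}" by (intro card_mono) auto
  also have "\<dots> \<le> 2" by (simp add: card_insert_if)
  finally show ?thesis .
qed (simp only: card.empty)

text \<open>Pigeonhole: each square has at most two roots and \<open>card K\<close> is odd, so the
  set of squares fills more than half of \<open>K\<close> and meets its image under
  \<open>s \<mapsto> r - s\<close>.\<close>

lemma sum_of_two_squares:
  assumes "r \<in> K" shows "\<exists>x\<in>K. \<exists>y\<in>K. x * x + y * y = r"
proof -
  let ?Q = "(\<lambda>x. x * x) ` K"
  have fQ: "finite ?Q" using finite_K by simp
  have "card K = (\<Sum>c\<in>?Q. card {x \<in> K. x * x = c})"
    using finite_K sum.group[of K ?Q "\<lambda>x. x * x" "\<lambda>_. 1 :: nat"] by simp
  also have "\<dots> \<le> (\<Sum>c\<in>?Q. 2)" by (intro sum_mono card_square_roots)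
  finally have "card K \<le> 2 * card ?Q" by simp
  then have "card K < 2 * card ?Q" using odd_card by (metis dvd_triv_left nat_less_le)
  moreover have c: "card ((\<lambda>s. r - s) ` ?Q) = card ?Q" by (intro card_image) (auto simp: inj_on_def)
  ultimately have "card K < card ?Q + card ((\<lambda>s. r - s) ` ?Q)" by simp
  moreover have "card (?Q \<union> (\<lambda>s. r - s) ` ?Q) \<le> card K"
    using finite_K assms by (intro card_mono) (auto simp: closed)
  ultimately have "?Q \<inter> (\<lambda>s. r - s) ` ?Q \<noteq> {}"
    using card_Un_disjoint[of ?Q "(\<lambda>s. r - s) ` ?Q"] fQ by auto
  then obtain x y where "x \<in> K" "y \<in> K" "x * x = r - y * y" by auto
  then show ?thesis by (intro bexI[of _ x] bexI[of _ y]) (auto simp: algebra_simps)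
qed

section \<open>The plane over the subfield and its axioms\<close>

definition A :: "'a gauss set" where "A = (\<lambda>(a, b). Gauss a b) ` (K \<times> K)"

fun cj :: "'a gauss \<Rightarrow> 'a gauss" where "cj (Gauss a b) = Gauss a (- b)"

lemma Gauss_in_A: "Gauss a b \<in> A \<longleftrightarrow> a \<in> K \<and> b \<in> K"
  by (auto simp: A_def)

lemma norm_Gauss: "Gauss a b * cj (Gauss a b) = Gauss (a * a + b * b) 0"
  by (simp add: algebra_simps)

lemma card_gauss_filter: "card {z \<in> A. P z} = card {p \<in> K \<times> K. P (Gauss (fst p) (snd p))}"
proof -
  have "bij_betw (\<lambda>p. Gauss (fst p) (snd p)) {p \<in> K \<times> K. P (Gauss (fst p) (snd p))} {z \<in> A. P z}"
    by (rule bij_betwI[where g = "case_gauss Pair"]) (auto simp: A_def)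
  then show ?thesis by (simp add: bij_betw_same_card)
qed

text \<open>In coordinates the axis is given by two linear equations whose determinant
  \<open>(e + \<alpha>) * (e - \<alpha>) - \<beta> * \<beta>\<close> vanishes because
  \<open>u\<close> has norm \<open>e\<close>. They are never both trivial, so the solutions form a
  line.\<close>

lemma card_axis_Gauss:
  assumes u: "u \<in> A" "u * cj u = Gauss e 0"
  shows "card {t \<in> A. t + u * cj t = 0} = card K"
proof -
  obtain \<alpha> \<beta> where ab: "u = Gauss \<alpha> \<beta>" "\<alpha> \<in> K" "\<beta> \<in> K" using u by (auto simp: A_def)
  have n: "\<alpha> * \<alpha> + \<beta> * \<beta> = e" using u ab by (simp add: norm_Gauss del: cj.simps)
  have iff: "Gauss a b + u * cj (Gauss a b) = 0 \<longleftrightarrow> (e + \<alpha>) * a + \<beta> * b = 0 \<and> (e - \<alpha>) * b + \<beta> * a = 0"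
    if "a \<in> K" "b \<in> K" for a b
    using that by (simp add: ab zero_gauss_def algebra_simps mult_unit)
  show ?thesis
  \<comment> \<open>If \<open>\<alpha> = - e\<close>, then \<open>\<beta> = 0\<close> and the second
    equation forces \<open>b = 0\<close>. Otherwise the first equation can be solved for
    \<open>a\<close>, and the second follows from the vanishing determinant.\<close>
  proof (cases "e + \<alpha> = 0")
    case True
    then have a: "\<alpha> = - e" by (simp add: add_eq_0_iff)
    then have "\<beta> * \<beta> = 0" using n unit_mult[OF unit_closed] by simp
    then have b: "\<beta> = 0" using no_zero_divisors ab by blast
    have "{t \<in> A. t + u * cj t = 0} = (\<lambda>a. Gauss a 0) ` K"
    proof (rule Set.set_eqI)
      fix t
      show "t \<in> {t \<in> A. t + u * cj t = 0} \<longleftrightarrow> t \<in> (\<lambda>a. Gauss a 0) ` K"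
      proof (cases t)
        case (Gauss x y)
        have "y \<in> K \<Longrightarrow> (e - \<alpha>) * y = 0 \<Longrightarrow> y = 0"
          using no_zero_divisors[of "e + e" y] two_nonzero by (simp add: a closed)
        then show ?thesis using iff[of x y] True b
          by (auto simp: Gauss Gauss_in_A closed simp del: cj.simps)
      qed
    qed
    then show ?thesis by (simp add: card_image inj_on_def)
  next
    case False
    then obtain i where i: "i \<in> K" "(e + \<alpha>) * i = e"
      using inverse[of "e + \<alpha>"] ab by (auto simp: closed)
    have "{t \<in> A. t + u * cj t = 0} = (\<lambda>b. Gauss (- (i * \<beta> * b)) b) ` K"
    proof (rule Set.set_eqI)
      fix t
      show "t \<in> {t \<in> A. t + u * cj t = 0} \<longleftrightarrow> t \<in> (\<lambda>b. Gauss (- (i * \<beta> * b)) b) ` K"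
      proof (cases t)
        case (Gauss x y)
        have 1: "x = - (i * \<beta> * y)" if "x \<in> K" "y \<in> K" "(e + \<alpha>) * x + \<beta> * y = 0"
        proof -
          have "x = ((e + \<alpha>) * i) * x" using i that by (simp add: unit_mult)
          also have "\<dots> = i * ((e + \<alpha>) * x)" by (simp only: mult_ac)
          also have "(e + \<alpha>) * x = - (\<beta> * y)" using that by (simp add: eq_neg_iff_add_eq_0)
          finally show ?thesis by (simp add: mult.assoc)
        qed
        have 2: "(e + \<alpha>) * (- (i * \<beta> * y)) + \<beta> * y = 0 \<and> (e - \<alpha>) * y + \<beta> * (- (i * \<beta> * y)) = 0"
          if y: "y \<in> K"
        proof
          have "(e + \<alpha>) * (- (i * \<beta> * y)) = - (((e + \<alpha>) * i) * (\<beta> * y))" by (simp add: mult_ac)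
          also have "\<dots> = - (\<beta> * y)" using i ab y by (simp add: unit_mult closed)
          finally show "(e + \<alpha>) * (- (i * \<beta> * y)) + \<beta> * y = 0" by simp
          have "\<beta> * \<beta> = (e + \<alpha>) * (e - \<alpha>)"
            using n ab unit_mult[OF unit_closed] unit_mult[of \<alpha>] mult_unit[of \<alpha>] by (simp add: algebra_simps)
          then have "\<beta> * (- (i * \<beta> * y)) = - (((e + \<alpha>) * i) * ((e - \<alpha>) * y))"
            by (metis (no_types, lifting) minus_mult_right mult.assoc mult.commute)
          also have "\<dots> = - ((e - \<alpha>) * y)" using i ab y by (simp add: unit_mult closed)
          finally show "(e - \<alpha>) * y + \<beta> * (- (i * \<beta> * y)) = 0" by simp
        qed
        have 3: "y \<in> K \<Longrightarrow> - (i * \<beta> * y) \<in> K" using i ab by (simp add: closed)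
        show ?thesis
        proof
          assume "t \<in> {t \<in> A. t + u * cj t = 0}"
          then have "x \<in> K" "y \<in> K" "(e + \<alpha>) * x + \<beta> * y = 0"
            using iff[of x y] by (auto simp: Gauss Gauss_in_A simp del: cj.simps)
          then show "t \<in> (\<lambda>b. Gauss (- (i * \<beta> * b)) b) ` K" using 1 Gauss by auto
        next
          assume "t \<in> (\<lambda>b. Gauss (- (i * \<beta> * b)) b) ` K"
          then have "y \<in> K" "x = - (i * \<beta> * y)" using Gauss by auto
          then show "t \<in> {t \<in> A. t + u * cj t = 0}"
            using iff[of x y] 2 3 by (simp add: Gauss Gauss_in_A del: cj.simps)
        qed
      qed
    qed
    then show ?thesis by (simp add: card_image inj_on_def)
  qed
qed

lemma conj_plane_Gauss: "conj_plane A (Gauss e 0) cj (card K)"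
proof
  let ?q = "card K"
  show "finite A" using finite_K by (simp add: A_def)
  show "?q \<ge> 3" by (rule card_ge)
  show "0 \<in> A" "Gauss e 0 \<in> A" by (auto simp: Gauss_in_A zero_gauss_def closed)
  show "x + y \<in> A" "x * y \<in> A" "cj (x + y) = cj x + cj y" "cj (x * y) = cj x * cj y"
    if "x \<in> A" "y \<in> A" for x y
    using that by (cases x; cases y; auto simp: Gauss_in_A closed)+
  show "- x \<in> A" "Gauss e 0 * x = x" "cj x \<in> A" "cj (cj x) = x" if "x \<in> A" for x
    using that by (cases x; auto simp: Gauss_in_A closed unit_mult)+
  show "x = 0" if x: "x \<in> A" "x * x = 0" for x
  proof (cases x)
    case (Gauss a b)
    then have ab: "a \<in> K" "b \<in> K" "a * a = b * b" "a * b + a * b = 0"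
      using x by (auto simp: Gauss_in_A zero_gauss_def mult.commute)
    then have "a * b = 0" using double_eq_0[of "a * b"] by (simp add: closed)
    then have "a = 0 \<or> b = 0" using no_zero_divisors ab by blast
    then have "a = 0 \<and> b = 0" using ab no_zero_divisors[of a a] no_zero_divisors[of b b] by auto
    then show ?thesis using Gauss by (simp add: zero_gauss_def)
  qed
  have real: "\<exists>a\<in>K. x = Gauss a 0 \<and> a \<noteq> 0" if x: "x \<in> A" "cj x = x" "x \<noteq> 0" for x
  proof (cases x)
    case (Gauss a b)
    then have "b + b = 0" "a \<in> K" "b \<in> K"
      using x by (auto simp: Gauss_in_A) (metis add.right_inverse)
    then have "b = 0" using double_eq_0 by blast
    then show ?thesis using Gauss x \<open>a \<in> K\<close> by (auto simp: zero_gauss_def)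
  qed
  show "\<exists>y\<in>A. x * y = Gauss e 0" if x: "x \<in> A" "cj x = x" "x \<noteq> 0" for x
  proof -
    obtain a where a: "a \<in> K" "x = Gauss a 0" "a \<noteq> 0" using real[OF x] by blast
    then obtain y where "y \<in> K" "a * y = e" using inverse by blast
    then show ?thesis using a by (intro bexI[of _ "Gauss y 0"]) (auto simp: Gauss_in_A closed)
  qed
  show "Gauss e 0 + Gauss e 0 \<noteq> 0" using two_nonzero by (simp add: zero_gauss_def)
  show "card A = ?q\<^sup>2"
    using card_gauss_filter[of "\<lambda>_. True"] by (simp add: card_cartesian_product power2_eq_square)
  show "card {t \<in> A. t + u * cj t = 0} = ?q" if "u \<in> A" "u * cj u = Gauss e 0" for u
    using card_axis_Gauss that by blast
  show "\<exists>z\<in>A. z * cj z = r" if r: "r \<in> A" "cj r = r" "r \<noteq> 0" for r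
  proof -
    obtain a where a: "a \<in> K" "r = Gauss a 0" using real[OF r] by blast
    then obtain x y where "x \<in> K" "y \<in> K" "x * x + y * y = a" using sum_of_two_squares by blast
    then show ?thesis using a
      by (intro bexI[of _ "Gauss x y"]) (auto simp: Gauss_in_A norm_Gauss simp del: cj.simps)
  qed
  show "card {z \<in> A. z * cj z = 0} \<le> 2 * ?q - 1"
  proof -
    \<comment> \<open>For second coordinate 0 only the origin is isotropic; each of the other
      \<open>?q - 1\<close> values admits at most two first coordinates.\<close>
    have "card {z \<in> A. z * cj z = 0} = card {p \<in> K \<times> K. fst p * fst p + snd p * snd p = 0}"
      by (simp add: card_gauss_filter norm_Gauss zero_gauss_def del: cj.simps)
    also have "\<dots> = (\<Sum>b\<in>K. card {a \<in> K. a * a + b * b = 0})"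
      by (simp add: card_Times_filter finite_K)
    also have "\<dots> = card {a \<in> K. a * a = 0} + (\<Sum>b\<in>K - {0}. card {a \<in> K. a * a = - (b * b)})"
      using finite_K zero_closed by (simp add: sum.remove[of K 0] eq_neg_iff_add_eq_0)
    also have "{a \<in> K. a * a = 0} = {0}" using no_zero_divisors zero_closed by auto
    also have "(\<Sum>b\<in>K - {0}. card {a \<in> K. a * a = - (b * b)}) \<le> (\<Sum>b\<in>K - {0}. 2)"
      by (intro sum_mono card_square_roots)
    also have "card {0 :: 'a} + (\<Sum>b\<in>K - {0}. 2) = 2 * ?q - 1"
      using finite_K zero_closed card_ge by (simp add: card_Diff_singleton)
    finally show ?thesis by simp
  qed
  show "card {h \<in> A. cj h = - h \<and> h * h = Gauss e 0} \<le> 2"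
  proof -
    have "{h \<in> A. cj h = - h \<and> h * h = Gauss e 0} \<subseteq> Gauss 0 ` {b \<in> K. b * b = - e}"
    proof
      fix h assume h: "h \<in> {h \<in> A. cj h = - h \<and> h * h = Gauss e 0}"
      obtain a b where ab: "h = Gauss a b" by (cases h)
      then have "a + a = 0" "a \<in> K" "b \<in> K"
        using h by (auto simp: Gauss_in_A eq_neg_iff_add_eq_0 zero_gauss_def)
      then have "a = 0" using double_eq_0 by blast
      then show "h \<in> Gauss 0 ` {b \<in> K. b * b = - e}" using h ab \<open>b \<in> K\<close> by auto
    qed
    then have "card {h \<in> A. cj h = - h \<and> h * h = Gauss e 0} \<le> card (Gauss 0 ` {b \<in> K. b * b = - e})"
      using finite_K by (intro card_mono) auto
    also have "\<dots> \<le> card {b \<in> K. b * b = - e}" using finite_K by (intro card_image_le) simp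
    also have "\<dots> \<le> 2" by (rule card_square_roots)
    finally show ?thesis .
  qed
qed

end

section \<open>Finite fields given by a ring record\<close>

text \<open>The product of all commutative rings on a type contains a copy of each of them, though with a
  different unit. Working inside this one type makes the class \<open>comm_ring\<close>, and with it the
  simplification of ring expressions, available for fields given by a record.\<close>

typedef 'a cring_prod =
  "{f :: 'a ring \<Rightarrow> 'a. \<forall>R. if cring R then f R \<in> carrier R else f R = undefined}"
  by (rule exI[of _ "\<lambda>R. if cring R then \<zero>\<^bsub>R\<^esub> else undefined"])
    (auto simp: cring_def ring.ring_simprules)

setup_lifting type_definition_cring_prod

instantiation cring_prod :: (type) comm_ring
begin

lift_definition zero_cring_prod :: "'a cring_prod"
  is "\<lambda>R. if cring R then \<zero>\<^bsub>R\<^esub> else undefined"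
  by (auto simp: cring_def ring.ring_simprules)

lift_definition plus_cring_prod :: "'a cring_prod \<Rightarrow> 'a cring_prod \<Rightarrow> 'a cring_prod"
  is "\<lambda>f g R. if cring R then f R \<oplus>\<^bsub>R\<^esub> g R else undefined"
  by (auto simp: cring_def ring.ring_simprules)

lift_definition minus_cring_prod :: "'a cring_prod \<Rightarrow> 'a cring_prod \<Rightarrow> 'a cring_prod"
  is "\<lambda>f g R. if cring R then f R \<ominus>\<^bsub>R\<^esub> g R else undefined"
  by (auto simp: cring_def ring.ring_simprules)

lift_definition uminus_cring_prod :: "'a cring_prod \<Rightarrow> 'a cring_prod"
  is "\<lambda>f R. if cring R then \<ominus>\<^bsub>R\<^esub> f R else undefined"
  by (auto simp: cring_def ring.ring_simprules)

lift_definition times_cring_prod :: "'a cring_prod \<Rightarrow> 'a cring_prod \<Rightarrow> 'a cring_prod"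
  is "\<lambda>f g R. if cring R then f R \<otimes>\<^bsub>R\<^esub> g R else undefined"
  by (auto simp: cring_def ring.ring_simprules)

instance
  by standard (transfer; auto simp: cring.cring_simprules split: if_splits intro!: ext;
    (metis cring.cring_simprules)?)+

end

text \<open>The element is placed in component \<open>F\<close> and extended by zero elsewhere. The
  image of the unit is therefore an idempotent that serves as unit of the image only.\<close>

lift_definition emb :: "'a ring \<Rightarrow> 'a \<Rightarrow> 'a cring_prod"
  is "\<lambda>F x R. if cring R then (if R = F \<and> x \<in> carrier F then x else \<zero>\<^bsub>R\<^esub>) else undefined"
  by (auto simp: cring_def ring.ring_simprules)

lemma emb_hom:
  assumes "cring F" "x \<in> carrier F" "y \<in> carrier F"
  shows emb_add: "emb F (x \<oplus>\<^bsub>F\<^esub> y) = emb F x + emb F y"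
    and emb_mult: "emb F (x \<otimes>\<^bsub>F\<^esub> y) = emb F x * emb F y"
    and emb_diff: "emb F (x \<ominus>\<^bsub>F\<^esub> y) = emb F x - emb F y"
    and emb_uminus: "emb F (\<ominus>\<^bsub>F\<^esub> x) = - emb F x"
  using assms by (transfer; auto simp: cring.cring_simprules fun_eq_iff)+

lemma emb_zero: "cring F \<Longrightarrow> emb F \<zero>\<^bsub>F\<^esub> = 0"
  by transfer (auto simp: fun_eq_iff)

lemma inj_on_emb: "cring F \<Longrightarrow> inj_on (emb F) (carrier F)"
  unfolding inj_on_def by transfer (auto simp: fun_eq_iff split: if_splits; metis)

lemma finite_subfield_emb:
  assumes F: "field F" "finite (carrier F)" "odd (card (carrier F))"
  shows "finite_subfield (emb F ` carrier F) (emb F \<one>\<^bsub>F\<^esub>)"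
proof -
  interpret field F by fact
  have c: "cring F" by (rule is_cring)
  show ?thesis
  proof
    show "finite (emb F ` carrier F)" using F by simp
    show "odd (card (emb F ` carrier F))" using F inj_on_emb[OF c] by (simp add: card_image)
    show "0 \<in> emb F ` carrier F" using emb_zero[OF c] by (metis imageI zero_closed)
    show "emb F \<one>\<^bsub>F\<^esub> \<in> emb F ` carrier F" by simp
    show "x + y \<in> emb F ` carrier F" if "x \<in> emb F ` carrier F" "y \<in> emb F ` carrier F" for x y
      using that by (auto simp flip: emb_add[OF c])
    show "x * y \<in> emb F ` carrier F" if "x \<in> emb F ` carrier F" "y \<in> emb F ` carrier F" for x y
      using that by (auto simp flip: emb_mult[OF c])
    show "- x \<in> emb F ` carrier F" if "x \<in> emb F ` carrier F" for x
      using that by (auto simp flip: emb_uminus[OF c])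
    show "emb F \<one>\<^bsub>F\<^esub> * x = x" if "x \<in> emb F ` carrier F" for x
      using that by (auto simp flip: emb_mult[OF c])
    show "emb F \<one>\<^bsub>F\<^esub> \<noteq> 0"
      using inj_on_emb[OF c] one_not_zero by (auto simp flip: emb_zero[OF c] dest: inj_onD)
    show "\<exists>y\<in>emb F ` carrier F. x * y = emb F \<one>\<^bsub>F\<^esub>" if x: "x \<in> emb F ` carrier F" "x \<noteq> 0" for x
    proof -
      obtain a where a: "a \<in> carrier F" "x = emb F a" using x by auto
      then have "a \<noteq> \<zero>\<^bsub>F\<^esub>" using x emb_zero[OF c] by auto
      then have "a \<in> Units F" using a by (simp add: field_Units)
      then have "inv\<^bsub>F\<^esub> a \<in> carrier F" "a \<otimes>\<^bsub>F\<^esub> inv\<^bsub>F\<^esub> a = \<one>\<^bsub>F\<^esub>" by auto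
      then show ?thesis using a
        by (intro bexI[of _ "emb F (inv\<^bsub>F\<^esub> a)"]) (auto simp flip: emb_mult[OF c])
    qed
  qed
qed

text \<open>The injection \<open>g\<close> carries the plane over \<open>F\<close> into the Gaussian
  plane, and \<open>h\<close> places field elements among its reals, turning distances into norms.
  The product set there lies in the image of the one in \<open>F\<close>, so its size is a lower
  bound.\<close>

lemma card_distance_product_ge:
  fixes F :: "'a ring"
  assumes F: "field F" "order F = q" "odd q" and E: "E \<subseteq> carrier F \<times> carrier F"
    and n: "real (card E) \<ge> 4 * real q powr (8 / 7)"
  shows "real (card (distance_set F E <#>\<^bsub>F\<^esub> distance_set F E)) \<ge> 1 / 416 * real q"
proof -
  interpret field F by fact
  have c: "cring F" by (rule is_cring)
  have q: "q = card (carrier F)" "q > 0" using F by (auto simp: order_def intro: odd_pos)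
  \<comment> \<open>An infinite carrier would have cardinality 0, which is not odd.\<close>
  then have fin: "finite (carrier F)" by (simp add: card_gt_0_iff)
  interpret S: finite_subfield "emb F ` carrier F" "emb F \<one>\<^bsub>F\<^esub>"
    using F(3) q(1) by (intro finite_subfield_emb F(1) fin) simp
  define g where "g p = Gauss (emb F (fst p)) (emb F (snd p))" for p
  define h where "h d = Gauss (emb F d) 0" for d
  let ?D = "distance_set F E"
  have cq: "card (emb F ` carrier F) = q" using q(1) card_image[OF inj_on_emb[OF c]] by simp
  interpret plane_set S.A "Gauss (emb F \<one>\<^bsub>F\<^esub>) 0" S.cj q "g ` E"
  proof (intro plane_set.intro plane_set_axioms.intro)
    show "conj_plane S.A (Gauss (emb F \<one>\<^bsub>F\<^esub>) 0) S.cj q"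
      using S.conj_plane_Gauss unfolding cq .
    show "g ` E \<subseteq> S.A" using E by (auto simp: g_def S.Gauss_in_A)
  qed
  have "inj_on g E"
    using E inj_on_emb[OF c] by (auto simp: inj_on_def g_def subset_iff)
  then have cE: "card (g ` E) = card E" by (rule card_image)
  have N: "N (g x - g y) = h (qnorm F (plane_diff F x y))" if "x \<in> E" "y \<in> E" for x y
  proof -
    have xy: "fst x \<in> carrier F" "snd x \<in> carrier F" "fst y \<in> carrier F" "snd y \<in> carrier F"
      using that E by auto
    have "g x - g y = Gauss (emb F (fst x \<ominus>\<^bsub>F\<^esub> fst y)) (emb F (snd x \<ominus>\<^bsub>F\<^esub> snd y))"
      using xy by (simp add: g_def emb_diff[OF c])
    then show ?thesis
      using xy by (simp add: N_def S.norm_Gauss h_def qnorm_def plane_diff_def numeral_2_eq_2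
        emb_add[OF c] emb_mult[OF c] del: S.cj.simps)
  qed
  have D: "?D \<subseteq> carrier F" using E by (fastforce simp: distance_set_def qnorm_def plane_diff_def)
  have \<Delta>_sub: "\<Delta> \<subseteq> h ` ?D" using N by (fastforce simp: \<Delta>_def distance_set_def)
  have hm: "h a * h b = h (a \<otimes>\<^bsub>F\<^esub> b)" if "a \<in> ?D" "b \<in> ?D" for a b
    using that D by (simp add: h_def emb_mult[OF c] subset_iff)
  have "a * b \<in> h ` (?D <#>\<^bsub>F\<^esub> ?D)" if ab: "a \<in> \<Delta>" "b \<in> \<Delta>" for a b
  proof -
    obtain a' b' where "a' \<in> ?D" "b' \<in> ?D" "a = h a'" "b = h b'" using ab \<Delta>_sub by blast
    then show ?thesis
      by (intro image_eqI[of _ _ "a' \<otimes>\<^bsub>F\<^esub> b'"]) (auto simp: hm set_mult_def)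
  qed
  then have sub: "{a * b | a b. a \<in> \<Delta> \<and> b \<in> \<Delta>} \<subseteq> h ` (?D <#>\<^bsub>F\<^esub> ?D)" by auto
  have finD: "finite (?D <#>\<^bsub>F\<^esub> ?D)"
    by (rule finite_subset[OF _ fin]) (use D in \<open>auto simp: set_mult_def subset_iff\<close>)
  have "card {a * b | a b. a \<in> \<Delta> \<and> b \<in> \<Delta>} \<le> card (?D <#>\<^bsub>F\<^esub> ?D)"
    using card_mono[OF _ sub] card_image_le[OF finD, of h] finD by simp
  moreover have "1 / 416 * real q \<le> real (card {a * b | a b. a \<in> \<Delta> \<and> b \<in> \<Delta>})"
    using n by (intro card_product_distance_set_ge) (simp add: cE)
  ultimately show ?thesis by linarith
qed

theorem theorem1p1:
  shows "\<exists>C c :: real. C > 0 \<and> c > 0 \<and>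
    (\<forall>(q :: nat) (F :: nat ring) (E :: (nat \<times> nat) set).
      primepow q \<longrightarrow> odd q \<longrightarrow> field F \<longrightarrow> order F = q \<longrightarrow>
      E \<subseteq> carrier F \<times> carrier F \<longrightarrow>
      real (card E) \<ge> C * real q powr (8 / 7) \<longrightarrow>
      real (card (distance_set F E <#>\<^bsub>F\<^esub> distance_set F E)) \<ge> c * real q)"
  using card_distance_product_ge by (intro exI[of _ 4] exI[of _ "1 / 416"]) auto

end
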